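(* Let $R$ be a Noetherian commutative ring of prime characteristic $p>0$, let $I$ be a non-zero proper ideal of $R$, and let $\mathfrak{a}_\bullet$ be a filtration of ideals in $R$. Let $\overline{\mathfrak{a}_\bullet}=\{\overline{\mathfrak{a}_i}\}_{i\ge 0}$ (integral closures) and $(\mathfrak{a}_\bullet)^*=\{(\mathfrak{a}_i)^*\}_{i\ge 0}$ (tight closures), which are filtrations of ideals in $R$. Suppose that $\mathcal{R}(\overline{\mathfrak{a}_\bullet})$ is a finitely generated $\mathcal{R}(\mathfrak{a}_\bullet)$-module. Then $$\mathcal{C}_{+}^I(\mathfrak{a}_\bullet)=\mathcal{C}_{+}^I((\mathfrak{a}_\bullet)^* )=\mathcal{C}_{+}^I(\overline{\mathfrak{a}_\bullet})\quad\text{and}\quad \mathcal{C}_{-}^I(\mathfrak{a}_\bullet)=\mathcal{C}_{-}^I((\mathfrak{a}_\bullet)^* )=\mathcal{C}_{-}^I(\overline{\mathfrak{a}_\bullet}).$$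
   Context: A filtration of ideals in $R$ is a sequence $\mathfrak{a}_\bullet=\{\mathfrak{a}_i\}_{i\ge 0}$ of ideals with $\mathfrak{a}_0=R$, $\mathfrak{a}_{i+1}\subseteq\mathfrak{a}_i$ for all $i\ge 0$, and $\mathfrak{a}_i\mathfrak{a}_j\subseteq \mathfrak{a}_{i+j}$ for all $i,j\ge 0$. Its Rees algebra is $\mathcal{R}(\mathfrak{a}_\bullet)=\bigoplus_{i\ge 0}\mathfrak{a}_it^i\subseteq R[t]$. For an ideal $I$, $I^{[p^e]}$ is the ideal generated by all $f^{p^e}$, $f\in I$. The tight closure $J^*$ of an ideal $J$ is the set of $x\in R$ for which there is $c\in R$ not in any minimal prime of $R$ with $cx^{p^e}\in J^{[p^e]}$ for all $e\gg 0$. For $e\ge 0$ put $\nu_{\mathfrak{a}_\bullet}^I(p^e)=\sup\{r\in\mathbb{Z}_{\ge 0}:\mathfrak{a}_r\not\subseteq I^{[p^e]}\}\in\mathbb{Z}_{\ge0}\cup\{\infty\}$, and define $\mathcal{C}_+^I(\mathfrak{a}_\bullet)=\limsup_{e\to\infty}\nu_{\mathfrak{a}_\bullet}^I(p^e)/p^e$ and $\mathcal{C}_-^I(\mathfrak{a}_\bullet)=\liminf_{e\to\infty}\nu_{\mathfrak{a}_\bullet}^I(p^e)/p^e$ (possibly $\infty$). *)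

theory Defs
  imports
    "HOL-Algebra.Ideal_Product"
    "HOL-Algebra.Ring_Divisibility"
    "HOL-Algebra.Embedded_Algebras"
    "HOL-Algebra.UnivPoly"
    "HOL-Library.Extended_Real"
    "HOL-Computational_Algebra.Primes"
begin

text \<open>Analogue of \<open>CHAR\<close>, which is available only for type classes; it is \<open>0\<close> if no positive
  multiple of \<open>\<one>\<close> vanishes.\<close>

definition ring_char :: "('a, 'b) ring_scheme \<Rightarrow> nat"
  where "ring_char R = Gcd {n. [n] \<cdot>\<^bsub>R\<^esub> \<one>\<^bsub>R\<^esub> = \<zero>\<^bsub>R\<^esub>}"

definition ideal_filtration :: "('a, 'b) ring_scheme \<Rightarrow> (nat \<Rightarrow> 'a set) \<Rightarrow> bool"
  where "ideal_filtration R \<aa> \<longleftrightarrow>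
    (\<forall>i. ideal (\<aa> i) R) \<and> \<aa> 0 = carrier R \<and>
    (\<forall>i. \<aa> (Suc i) \<subseteq> \<aa> i) \<and> (\<forall>i j. ideal_prod R (\<aa> i) (\<aa> j) \<subseteq> \<aa> (i + j))"

text \<open>The summand \<open>\<aa>\<^sub>i t\<^sup>i\<close> consists of the degree \<open>i\<close> terms with coefficient in \<open>\<aa>\<^sub>i\<close>.\<close>

definition rees_algebra :: "('a, 'b) ring_scheme \<Rightarrow> (nat \<Rightarrow> 'a set) \<Rightarrow> (nat \<Rightarrow> 'a) set"
  where "rees_algebra R \<aa> = {f \<in> carrier (UP R). \<forall>i. coeff (UP R) f i \<in> \<aa> i}"

text \<open>\<open>M \<subseteq> S\<close> as a module over a subring \<open>A\<close> of \<open>S\<close>, acting by the multiplication of \<open>S\<close>.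
  The library's \<open>Span\<close> is the set of \<open>A\<close>-linear combinations of a list; its definition does not
  need \<open>A\<close> to be a field.\<close>

definition fin_gen_over :: "('a, 'b) ring_scheme \<Rightarrow> 'a set \<Rightarrow> 'a set \<Rightarrow> bool"
  where "fin_gen_over S A M \<longleftrightarrow> (\<exists>gs. set gs \<subseteq> M \<and> M = ring.Span S A gs)"

text \<open>Powers of ideals are taken in the library's semiring \<open>ideals_set R\<close>, so \<open>J\<^sup>0 = R\<close>.\<close>

definition integral_closure :: "('a, 'b) ring_scheme \<Rightarrow> 'a set \<Rightarrow> 'a set"
  where "integral_closure R J =
    {x \<in> carrier R. \<exists>n::nat. n > 0 \<and> (\<exists>b. (\<forall>i\<in>{1..n}. b i \<in> J [^]\<^bsub>ideals_set R\<^esub> i) \<and>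
       x [^]\<^bsub>R\<^esub> n \<oplus>\<^bsub>R\<^esub> (\<Oplus>\<^bsub>R\<^esub>i\<in>{1..n}. b i \<otimes>\<^bsub>R\<^esub> x [^]\<^bsub>R\<^esub> (n - i)) = \<zero>\<^bsub>R\<^esub>)}"

definition minimal_prime :: "('a, 'b) ring_scheme \<Rightarrow> 'a set \<Rightarrow> bool"
  where "minimal_prime R P \<longleftrightarrow> primeideal P R \<and> (\<forall>Q. primeideal Q R \<and> Q \<subseteq> P \<longrightarrow> Q = P)"

definition bracket_power :: "('a, 'b) ring_scheme \<Rightarrow> 'a set \<Rightarrow> nat \<Rightarrow> 'a set"
  where "bracket_power R J q = Idl\<^bsub>R\<^esub> {f [^]\<^bsub>R\<^esub> q | f. f \<in> J}"

definition tight_closure :: "('a, 'b) ring_scheme \<Rightarrow> nat \<Rightarrow> 'a set \<Rightarrow> 'a set"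
  where "tight_closure R p J =
    {x \<in> carrier R. \<exists>c\<in>carrier R. (\<forall>P. minimal_prime R P \<longrightarrow> c \<notin> P) \<and>
       (\<forall>\<^sub>F e in sequentially. c \<otimes>\<^bsub>R\<^esub> x [^]\<^bsub>R\<^esub> (p ^ e) \<in> bracket_power R J (p ^ e))}"

text \<open>The supremum is taken in \<^typ>\<open>enat\<close>, where it is \<open>\<infinity>\<close> for unbounded sets. When \<open>I\<close> is
  proper and \<open>\<aa> 0 = carrier R\<close>, the set contains \<open>0\<close>.\<close>

definition nu :: "('a, 'b) ring_scheme \<Rightarrow> nat \<Rightarrow> 'a set \<Rightarrow> (nat \<Rightarrow> 'a set) \<Rightarrow> nat \<Rightarrow> enat"
  where "nu R p I \<aa> e = (SUP r\<in>{r. \<not> \<aa> r \<subseteq> bracket_power R I (p ^ e)}. enat r)"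

definition C_plus :: "('a, 'b) ring_scheme \<Rightarrow> nat \<Rightarrow> 'a set \<Rightarrow> (nat \<Rightarrow> 'a set) \<Rightarrow> ereal"
  where "C_plus R p I \<aa> = limsup (\<lambda>e. ereal_of_enat (nu R p I \<aa> e) / ereal (real (p ^ e)))"

definition C_minus :: "('a, 'b) ring_scheme \<Rightarrow> nat \<Rightarrow> 'a set \<Rightarrow> (nat \<Rightarrow> 'a set) \<Rightarrow> ereal"
  where "C_minus R p I \<aa> = liminf (\<lambda>e. ereal_of_enat (nu R p I \<aa> e) / ereal (real (p ^ e)))"

end

theory Submission
  imports Defs
begin

text \<open>Both limits are monotone in the filtration and \<open>\<aa>\<^sub>i \<subseteq> \<aa>\<^sub>i\<^sup>* \<subseteq> integral_closure \<aa>\<^sub>i\<close>, so only the limits of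
  the integral closures have to be bounded by those of \<open>\<aa>\<close>. If all generators of the Rees algebra of
  the integral closures have degree at most \<open>D\<close>, comparing coefficients shows that the integral closure
  of \<open>\<aa>\<^sub>r\<close> lies in \<open>\<aa>\<^bsub>r - D\<^esub>\<close>, so \<open>\<nu>\<close> grows by at most \<open>D\<close>, which is negligible after division
  by \<open>p\<^sup>e\<close>.

  What is used about the closures follows from one criterion: if \<open>c\<close> avoids the minimal primes and
  \<open>c x\<^sup>q \<in> J\<^bsup>q - k\<^esup>\<close> for infinitely many \<open>q = p\<^sup>e\<close>, then \<open>x\<close> is integral over \<open>J\<close>. With \<open>k = 0\<close> it gives
  \<open>J\<^sup>* \<subseteq> integral_closure J\<close>; with \<open>c = 1\<close> it characterises integrality by a condition that is
  compatible with sums (through the Frobenius map) and products. The criterion holds because the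
  Rees algebra of \<open>J\<close> is Noetherian.\<close>

(* The infix of ideal_prod clashes with the notation of add_pow. *)
no_notation ideal_prod (infixl "\<cdot>\<index>" 80)

section \<open>The Frobenius map\<close>

context cring
begin

lemma binomial_cring:
  assumes "x \<in> carrier R" "y \<in> carrier R"
  shows "(x \<oplus> y) [^] n = (\<Oplus>k\<in>{..n}. [(n choose k)] \<cdot> (x [^] k \<otimes> y [^] (n - k)))"
proof (induction n)
  case 0
  then show ?case using assms by simp
next
  case (Suc n)
  let ?T = "\<lambda>n k. [(n choose k)] \<cdot> (x [^] k \<otimes> y [^] (n - k))"
  have T: "?T n k \<in> carrier R" for n k using assms by simp
  \<comment> \<open>Pascal's rule. For \<open>k = n\<close> the summand \<open>?T n (Suc n)\<close>
    vanishes with its binomial coefficient.\<close>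
  have step: "?T (Suc n) (Suc k) = x \<otimes> ?T n k \<oplus> y \<otimes> ?T n (Suc k)" if "k \<le> n" for k
  proof (cases "k = n")
    case True
    then show ?thesis using assms by (simp add: m_comm binomial_eq_0)
  next
    case False
    then have "n - k = Suc (n - Suc k)" using that by simp
    then show ?thesis
      using assms by (simp add: add_pow_rdistr add_pow_ldistr add.nat_pow_mult[symmetric] m_ac)
  qed
  have "(\<Oplus>k\<in>{..Suc n}. ?T (Suc n) k)
      = (\<Oplus>k\<in>{..n}. ?T (Suc n) (Suc k)) \<oplus> ?T (Suc n) 0"
    using T by (intro finsum_Suc2) blast
  also have "(\<Oplus>k\<in>{..n}. ?T (Suc n) (Suc k)) = (\<Oplus>k\<in>{..n}. x \<otimes> ?T n k \<oplus> y \<otimes> ?T n (Suc k))"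
    using step assms by (intro finsum_cong') auto
  also have "\<dots> = x \<otimes> (\<Oplus>k\<in>{..n}. ?T n k) \<oplus> y \<otimes> (\<Oplus>k\<in>{..n}. ?T n (Suc k))"
    using assms T by (subst finsum_addf) (auto simp: finsum_rdistr simp del: add.nat_pow_Suc)
  also have "?T (Suc n) 0 = y \<otimes> ?T n 0"
    using assms by (simp add: m_comm)
  also have "x \<otimes> (\<Oplus>k\<in>{..n}. ?T n k) \<oplus> y \<otimes> (\<Oplus>k\<in>{..n}. ?T n (Suc k)) \<oplus> y \<otimes> ?T n 0
      = x \<otimes> (\<Oplus>k\<in>{..n}. ?T n k) \<oplus> y \<otimes> ((\<Oplus>k\<in>{..n}. ?T n (Suc k)) \<oplus> ?T n 0)"
    using assms by (subst r_distr) (auto simp: a_assoc intro!: finsum_closed)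
  also have "(\<Oplus>k\<in>{..n}. ?T n (Suc k)) \<oplus> ?T n 0 = (\<Oplus>k\<in>{..Suc n}. ?T n k)"
    using T by (intro finsum_Suc2[symmetric]) blast
  also have "\<dots> = (\<Oplus>k\<in>{..n}. ?T n k)"
    using assms T by (simp add: finsum_Suc binomial_eq_0)
  also have "x \<otimes> (\<Oplus>k\<in>{..n}. ?T n k) \<oplus> y \<otimes> (\<Oplus>k\<in>{..n}. ?T n k)
      = (x \<oplus> y) [^] n \<otimes> (x \<oplus> y)"
    using assms Suc by (subst l_distr[symmetric]) (auto simp: m_comm intro!: finsum_closed)
  finally show ?case by simp
qed

text \<open>The binomial coefficients strictly between the two ends are divisible by
  \<open>p\<close>, so only the summands \<open>k = 0\<close> and \<open>k = p\<close>
  survive.\<close>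

lemma frobenius_add:
  fixes p :: nat
  assumes p: "prime p" "[p] \<cdot> \<one> = \<zero>" and x: "x \<in> carrier R" and y: "y \<in> carrier R"
  shows "(x \<oplus> y) [^] p = x [^] p \<oplus> y [^] p"
proof -
  let ?T = "\<lambda>k. [(p choose k)] \<cdot> (x [^] k \<otimes> y [^] (p - k))"
  have mult_zero: "[m] \<cdot> a = \<zero>" if m: "p dvd m" and a: "a \<in> carrier R" for a m
  proof -
    obtain k where "m = p * k" using m by blast
    moreover have "[p] \<cdot> (\<one> \<otimes> a) = \<zero>"
      using p(2) a by (simp only: add_pow_ldistr[symmetric] one_closed) simp
    ultimately show ?thesis using a by (simp add: add.nat_pow_pow[symmetric])
  qed
  have p0: "p > 0" using p(1) prime_gt_0_nat by blast
  have "(x \<oplus> y) [^] p = (\<Oplus>k\<in>{..p}. ?T k)" using x y by (rule binomial_cring)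
  also have "\<dots> = (\<Oplus>k\<in>{0,p}. ?T k)"
  proof (rule add.finprod_mono_neutral_cong_right)
    show "?T k = \<zero>" if "k \<in> {..p} - {0,p}" for k
      using p x y that by (intro mult_zero dvd_choose_prime) auto
  qed (use x y p0 in auto)
  also have "\<dots> = x [^] p \<oplus> y [^] p"
    using x y p0 by (simp add: finsum_insert a_comm)
  finally show ?thesis .
qed

lemma frobenius_power_add:
  fixes p :: nat
  assumes "prime p" "[p] \<cdot> \<one> = \<zero>" "x \<in> carrier R" "y \<in> carrier R"
  shows "(x \<oplus> y) [^] (p ^ e) = x [^] (p ^ e) \<oplus> y [^] (p ^ e)"
proof (induction e)
  case 0
  then show ?case using assms by simp
next
  case (Suc e)
  have "(x \<oplus> y) [^] (p ^ Suc e) = ((x \<oplus> y) [^] (p ^ e)) [^] p"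
    using assms by (simp add: nat_pow_pow mult.commute)
  also have "\<dots> = (x [^] (p ^ e)) [^] p \<oplus> (y [^] (p ^ e)) [^] p"
    using assms by (simp add: Suc frobenius_add)
  also have "\<dots> = x [^] (p ^ Suc e) \<oplus> y [^] (p ^ Suc e)"
    using assms by (simp add: nat_pow_pow mult.commute)
  finally show ?case .
qed

end

text \<open>Division with remainder shows that the least positive \<open>m\<close> with
  \<open>[m] \<cdot> \<one> = \<zero>\<close> divides every such number, so it is the
  \<open>Gcd\<close>. Hence the \<open>Gcd\<close> itself belongs to the set.\<close>

lemma (in ring) ring_char_add_pow:
  assumes "ring_char R = p" "p > 0"
  shows "[p] \<cdot> \<one> = \<zero>"
proof -
  let ?S = "{n::nat. [n] \<cdot> \<one> = \<zero>}"
  have "\<exists>n. n \<in> ?S \<and> n > 0"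
    using assms unfolding ring_char_def by (metis Gcd_0_iff empty_iff insert_iff not_gr0 subsetI)
  then obtain m where m: "m \<in> ?S" "m > 0" and min: "\<And>n. n \<in> ?S \<Longrightarrow> n > 0 \<Longrightarrow> m \<le> n"
    using exists_least_iff[of "\<lambda>n. n \<in> ?S \<and> n > 0"] by (metis (lifting) not_le)
  have "m dvd n" if n: "n \<in> ?S" for n
  proof -
    have "[(m * (n div m))] \<cdot> \<one> \<oplus> [(n mod m)] \<cdot> \<one> = [n] \<cdot> \<one>"
      by (simp add: add.nat_pow_mult)
    moreover have "[(m * (n div m))] \<cdot> \<one> = \<zero>"
      using m by (simp add: add.nat_pow_pow[symmetric])
    ultimately have "n mod m \<in> ?S" using n by simp
    then show ?thesis using min[of "n mod m"] m(2) by (metis mod_less_divisor not_le not_gr0 dvd_eq_mod_eq_0)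
  qed
  then have "Gcd ?S = m"
    using m(1) by (intro dvd_antisym Gcd_dvd Gcd_greatest) auto
  then show ?thesis using assms m(1) by (simp add: ring_char_def)
qed

section \<open>Graded modules over the Rees algebra of an ideal\<close>

context cring
begin

section \<open>Ideals and their powers\<close>

lemma idealI_cring:
  assumes "S \<subseteq> carrier R" "\<zero> \<in> S" "\<And>a b. a \<in> S \<Longrightarrow> b \<in> S \<Longrightarrow> a \<oplus> b \<in> S"
    and mult: "\<And>r a. r \<in> carrier R \<Longrightarrow> a \<in> S \<Longrightarrow> r \<otimes> a \<in> S"
  shows "ideal S R"
proof -
  have "subgroup S (add_monoid R)"
  proof
    fix a assume a: "a \<in> S"
    then have "\<ominus> a = (\<ominus> \<one>) \<otimes> a" using assms(1) by (auto simp: l_minus)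
    then show "inv\<^bsub>add_monoid R\<^esub> a \<in> S" using mult[OF _ a, of "\<ominus> \<one>"] by (simp add: a_inv_def)
  qed (use assms in auto)
  moreover have "a \<otimes> r \<in> S" if "a \<in> S" "r \<in> carrier R" for a r
    using mult[OF that(2,1)] m_comm[of a r] that assms(1) by auto
  ultimately show ?thesis using mult by (intro idealI ring_axioms) auto
qed

lemma ideal_minus_closed:
  assumes "ideal I R" "a \<in> I" "b \<in> I"
  shows "a \<ominus> b \<in> I"
  unfolding a_minus_def
  using assms additive_subgroup.a_closed additive_subgroup.a_inv_closed ideal.axioms(1) by metis

lemma ideal_finsum_closed:
  assumes I: "ideal I R" and f: "\<And>i. i \<in> A \<Longrightarrow> f i \<in> I"
  shows "(\<Oplus>i\<in>A. f i) \<in> I"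
proof (cases "finite A")
  case True
  then show ?thesis using f
  proof induction
    case empty
    then show ?case using additive_subgroup.zero_closed[OF ideal.axioms(1)[OF I]] by simp
  next
    case (insert x A)
    have "f \<in> A \<rightarrow> carrier R" "f x \<in> carrier R" using insert.prems ideal.Icarr[OF I] by auto
    then show ?case
      using insert additive_subgroup.a_closed[OF ideal.axioms(1)[OF I]] by (simp add: finsum_insert)
  qed
qed (use additive_subgroup.zero_closed[OF ideal.axioms(1)[OF I]] in \<open>simp add: finsum_infinite\<close>)

text \<open>Names the power that occurs in \<open>integral_closure\<close>, so that the recursion of
  \<open>ipow_0\<close> and \<open>ipow_Suc\<close> can be used without unfolding
  \<open>ideals_set\<close>.\<close>

definition ipow :: "'a set \<Rightarrow> nat \<Rightarrow> 'a set"
  where "ipow J n = J [^]\<^bsub>ideals_set R\<^esub> n"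

lemma ipow_0 [simp]: "ipow J 0 = carrier R"
  by (simp add: ipow_def nat_pow_def ideals_set_def)

lemma ipow_Suc [simp]: "ipow J (Suc n) = ideal_prod R (ipow J n) J"
  by (simp add: ipow_def nat_pow_def ideals_set_def)

lemma ipow_ideal: "ideal J R \<Longrightarrow> ideal (ipow J n) R"
  by (induction n) (simp_all add: oneideal ideal_prod_is_ideal)

lemma ipow_closed: "ideal J R \<Longrightarrow> a \<in> ipow J n \<Longrightarrow> a \<in> carrier R"
  by (rule ideal.Icarr[OF ipow_ideal])

lemma ipow_1: "ideal J R \<Longrightarrow> ipow J (Suc 0) = J"
  by (simp add: ideal_prod_commute ideal_prod_one oneideal)

lemma ipow_add:
  assumes "ideal J R"
  shows "ipow J (i + j) = ideal_prod R (ipow J i) (ipow J j)"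
proof -
  interpret I: comm_monoid "ideals_set R" by (rule ideals_set_is_comm_monoid)
  show ?thesis
    using I.nat_pow_mult[of J i j] assms by (simp add: ipow_def ideals_set_def)
qed

lemma ipow_mult:
  assumes "ideal J R" "a \<in> ipow J i" "b \<in> ipow J j"
  shows "a \<otimes> b \<in> ipow J (i + j)"
  using assms by (simp add: ipow_add ideal_prod.prod)

lemma ipow_antimono:
  assumes "ideal J R" "i \<le> j"
  shows "ipow J j \<subseteq> ipow J i"
  using ideal_prod_inter[of "ipow J i" "ipow J (j - i)"] ipow_add[of J i "j - i"] assms
  by (simp add: ipow_ideal)

lemma ideal_prod_mono: "I \<subseteq> I' \<Longrightarrow> J \<subseteq> J' \<Longrightarrow> ideal_prod R I J \<subseteq> ideal_prod R I' J'"
proof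
  fix s assume *: "I \<subseteq> I'" "J \<subseteq> J'" and "s \<in> ideal_prod R I J"
  from this(3) show "s \<in> ideal_prod R I' J'"
  proof induction
    case (prod i j)
    show ?case using prod * by (blast intro: ideal_prod.prod)
  next
    case (sum s1 s2)
    show ?case using sum.IH by (rule ideal_prod.sum)
  qed
qed

lemma ipow_mono: "J \<subseteq> K \<Longrightarrow> ipow J n \<subseteq> ipow K n"
  by (induction n) (simp_all add: ideal_prod_mono)

lemma nat_pow_in_ipow: "ideal J R \<Longrightarrow> x \<in> J \<Longrightarrow> x [^] n \<in> ipow J n"
  by (induction n) (auto intro: ideal_prod.prod)

lemma ipow_ideal_prod:
  assumes "ideal J R" "ideal K R"
  shows "ipow (ideal_prod R J K) n = ideal_prod R (ipow J n) (ipow K n)"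
proof -
  interpret I: comm_monoid "ideals_set R" by (rule ideals_set_is_comm_monoid)
  show ?thesis
    using I.nat_pow_distrib[of J K n] assms by (simp add: ipow_def ideals_set_def)
qed

section \<open>Spans of homogeneous elements over a Rees algebra\<close>

text \<open>Elements \<open>y t\<^sup>e\<close> of \<open>R[t]\<close> are represented by pairs \<open>(e, y)\<close>: \<open>gspan J Y d\<close> is the degree \<open>d\<close>
  part of the submodule spanned by \<open>Y\<close> over the Rees algebra of the powers of \<open>J\<close>.\<close>

inductive_set gspan :: "'a set \<Rightarrow> (nat \<times> 'a) set \<Rightarrow> nat \<Rightarrow> 'a set"
  for J Y d where
    zero: "\<zero> \<in> gspan J Y d"
  | step: "\<lbrakk>(e, y) \<in> Y; e \<le> d; u \<in> ipow J (d - e); v \<in> gspan J Y d\<rbrakk>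
      \<Longrightarrow> u \<otimes> y \<oplus> v \<in> gspan J Y d"

lemma gspan_closed:
  assumes "ideal J R" "snd ` Y \<subseteq> carrier R" "v \<in> gspan J Y d"
  shows "v \<in> carrier R"
  using assms(3)
proof induction
  case (step e y u v)
  then have "u \<in> carrier R" "y \<in> carrier R" using assms ipow_closed by auto
  then show ?case using step by simp
qed simp

lemma gspan_add:
  assumes J: "ideal J R" and Y: "snd ` Y \<subseteq> carrier R" and "v \<in> gspan J Y d" "w \<in> gspan J Y d"
  shows "v \<oplus> w \<in> gspan J Y d"
  using assms(3)
proof induction
  case zero
  then show ?case using assms gspan_closed by simp
next
  case (step e y u v)
  have "y \<in> carrier R" "u \<in> carrier R" "v \<in> carrier R" "w \<in> carrier R"
    using step Y J assms ipow_closed gspan_closed by auto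
  then have "u \<otimes> y \<oplus> v \<oplus> w = u \<otimes> y \<oplus> (v \<oplus> w)" by (simp add: a_assoc)
  then show ?case using step gspan.step by simp
qed

lemma gspan_gen:
  assumes "ideal J R" "snd ` Y \<subseteq> carrier R" "(e, y) \<in> Y" "e \<le> d" "u \<in> ipow J (d - e)"
  shows "u \<otimes> y \<in> gspan J Y d"
proof -
  have "u \<otimes> y \<oplus> \<zero> \<in> gspan J Y d" using assms by (intro gspan.intros)
  moreover have "y \<in> carrier R" "u \<in> carrier R" using assms ipow_closed by auto
  ultimately show ?thesis by simp
qed

lemma gspan_base:
  assumes "ideal J R" "snd ` Y \<subseteq> carrier R" "(d, y) \<in> Y"
  shows "y \<in> gspan J Y d"
proof -
  have "\<one> \<otimes> y \<in> gspan J Y d" using assms by (intro gspan_gen[where e=d]) auto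
  then show ?thesis using assms by force
qed

text \<open>Multiplication by \<open>b\<close> is additive, so it is enough to treat single terms
  \<open>u \<otimes> y\<close>. Generating set and degree may change, which covers scalar
  multiplication, change of generators and shifts by powers of an element.\<close>

lemma gspan_subst:
  assumes J: "ideal J R" and Y: "snd ` Y \<subseteq> carrier R" and Z: "snd ` Z \<subseteq> carrier R" and b: "b \<in> carrier R"
    and sub: "\<And>e y u. (e, y) \<in> Y \<Longrightarrow> e \<le> d \<Longrightarrow> u \<in> ipow J (d - e) \<Longrightarrow> u \<otimes> (y \<otimes> b) \<in> gspan K Z d'"
    and K: "ideal K R"
    and v: "v \<in> gspan J Y d"
  shows "v \<otimes> b \<in> gspan K Z d'"
  using v
proof induction
  case zero
  then show ?case using b by (simp add: gspan.zero)
next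
  case (step e y u v)
  have "y \<in> carrier R" "u \<in> carrier R" "v \<in> carrier R"
    using step Y J assms ipow_closed gspan_closed by auto
  then have "(u \<otimes> y \<oplus> v) \<otimes> b = u \<otimes> (y \<otimes> b) \<oplus> v \<otimes> b" using b by (simp add: l_distr m_assoc)
  moreover have "u \<otimes> (y \<otimes> b) \<oplus> v \<otimes> b \<in> gspan K Z d'"
    using gspan_add[OF K Z sub[OF step.hyps(1-3)] step.IH] .
  ultimately show ?case by simp
qed

lemma gspan_smult:
  assumes J: "ideal J R" and Y: "snd ` Y \<subseteq> carrier R" and a: "a \<in> ipow J k" and v: "v \<in> gspan J Y d"
  shows "v \<otimes> a \<in> gspan J Y (d + k)"
proof (rule gspan_subst[OF J Y Y _ _ J v])
  show ac: "a \<in> carrier R" using J a ipow_closed by simp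
  fix e y u assume *: "(e, y) \<in> Y" "e \<le> d" "u \<in> ipow J (d - e)"
  then have "y \<in> carrier R" "u \<in> carrier R" using Y J ipow_closed by auto
  then have "u \<otimes> (y \<otimes> a) = (u \<otimes> a) \<otimes> y" using ac by (simp add: m_ac)
  moreover have "u \<otimes> a \<in> ipow J (d + k - e)"
    using ipow_mult[OF J *(3) a] * by simp
  ultimately show "u \<otimes> (y \<otimes> a) \<in> gspan J Y (d + k)"
    using * gspan_gen[OF J Y *(1)] by simp
qed

lemma gspan_ideal:
  assumes J: "ideal J R" and Y: "snd ` Y \<subseteq> carrier R"
  shows "ideal (gspan J Y d) R"
proof (rule idealI_cring)
  show "gspan J Y d \<subseteq> carrier R" using gspan_closed[OF J Y] by blast
  \<comment> \<open>\<open>ipow J 0\<close> is the whole ring, so this is multiplication by an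
    element of degree \<open>0\<close>.\<close>
  show "r \<otimes> v \<in> gspan J Y d" if "r \<in> carrier R" "v \<in> gspan J Y d" for r v
    using gspan_smult[OF J Y, of r 0 v d] gspan_closed[OF J Y] that by (simp add: m_comm)
qed (use gspan.zero gspan_add[OF J Y] in auto)

lemma gspan_trans:
  assumes J: "ideal J R" and Y: "snd ` Y \<subseteq> carrier R" and Z: "snd ` Z \<subseteq> carrier R"
    and sub: "\<And>e y. (e, y) \<in> Y \<Longrightarrow> y \<in> gspan J Z e"
    and v: "v \<in> gspan J Y d"
  shows "v \<in> gspan J Z d"
proof -
  have "v \<otimes> \<one> \<in> gspan J Z d"
  proof (rule gspan_subst[OF J Y Z _ _ J v])
    fix e y u assume *: "(e, y) \<in> Y" "e \<le> d" "u \<in> ipow J (d - e)"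
    then have "y \<otimes> u \<in> gspan J Z (e + (d - e))"
      using J Z sub by (intro gspan_smult) auto
    moreover have "y \<in> carrier R" "u \<in> carrier R" using * Y J ipow_closed by auto
    ultimately show "u \<otimes> (y \<otimes> \<one>) \<in> gspan J Z d" using * by (simp add: m_comm)
  qed simp
  then show ?thesis using gspan_closed[OF J Y v] by simp
qed

lemma gspan_mono:
  assumes "Y \<subseteq> Z" "v \<in> gspan J Y d"
  shows "v \<in> gspan J Z d"
  using assms(2)
proof induction
  case zero
  show ?case by (rule gspan.zero)
next
  case (step e y u v)
  show ?case using step.hyps(1) assms(1) step.hyps(2,3) step.IH by (intro gspan.step[of e y]) auto
qed

lemma gspan_finite_support:
  assumes "v \<in> gspan J Y d"
  shows "\<exists>Y0 \<subseteq> Y. finite Y0 \<and> v \<in> gspan J Y0 d"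
  using assms
proof induction
  case zero
  then show ?case using gspan.zero by blast
next
  case (step e y u v)
  then obtain Y0 where Y0: "Y0 \<subseteq> Y" "finite Y0" "v \<in> gspan J Y0 d" by blast
  have "u \<otimes> y \<oplus> v \<in> gspan J (insert (e, y) Y0) d"
    using step Y0 gspan_mono[of Y0 "insert (e, y) Y0"] by (intro gspan.step[of e y]) auto
  then show ?case using Y0 step by (intro exI[of _ "insert (e, y) Y0"]) auto
qed

text \<open>Replaces finitely many spanned elements by finitely many of the given generators, so
  that finite generation can always be achieved by a subset of \<open>Y\<close>.\<close>

lemma gspan_finite_supports:
  assumes "finite B" "\<And>d v. (d, v) \<in> B \<Longrightarrow> v \<in> gspan J Y d"
  shows "\<exists>Y0 \<subseteq> Y. finite Y0 \<and> (\<forall>(d, v) \<in> B. v \<in> gspan J Y0 d)"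
  using assms
proof (induction B)
  case empty
  then show ?case by blast
next
  case (insert b B)
  obtain d v where b: "b = (d, v)" by fastforce
  obtain Y0 where Y0: "Y0 \<subseteq> Y" "finite Y0" "\<forall>(d, v) \<in> B. v \<in> gspan J Y0 d"
    using insert.IH insert.prems by auto
  obtain Y1 where Y1: "Y1 \<subseteq> Y" "finite Y1" "v \<in> gspan J Y1 d"
    using gspan_finite_support[OF insert.prems[of d v]] b by auto
  have "\<forall>(d, v) \<in> insert b B. v \<in> gspan J (Y0 \<union> Y1) d"
    using Y0(3) gspan_mono[OF _ Y1(3), of "Y0 \<union> Y1"] b by (auto intro: gspan_mono[of Y0])
  then show ?case using Y0 Y1 by (intro exI[of _ "Y0 \<union> Y1"]) auto
qed

text \<open>The multiples of the new generator can be collected into one because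
  \<open>ipow J (d - e)\<close> is closed under addition. For \<open>d < e\<close> the new generator
  cannot occur in degree \<open>d\<close>, hence the first alternative.\<close>

lemma gspan_insert_cases:
  assumes J: "ideal J R" and Y: "snd ` Y \<subseteq> carrier R" and y: "y \<in> carrier R"
    and v: "v \<in> gspan J (insert (e, y) Y) d"
  shows "v \<in> gspan J Y d \<or> e \<le> d \<and> (\<exists>u \<in> ipow J (d - e). \<exists>w \<in> gspan J Y d. v = u \<otimes> y \<oplus> w)"
  using v
proof induction
  case zero
  then show ?case by (simp add: gspan.zero)
next
  case (step e' y' u' v')
  have c: "u' \<in> carrier R" "y' \<in> carrier R" using step J Y y ipow_closed by auto
  have wc: "w \<in> carrier R" if "w \<in> gspan J Y d" for w using gspan_closed[OF J Y that] .
  have uc: "u \<in> carrier R" if "u \<in> ipow J k" for u k using ipow_closed[OF J that] .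
  show ?case
  proof (cases "(e', y') = (e, y)")
    case True
    from step.IH show ?thesis
    proof
      assume "v' \<in> gspan J Y d"
      moreover have "e \<le> d" "u' \<in> ipow J (d - e)" using True step.hyps by auto
      ultimately show ?thesis using True by auto
    next
      assume "e \<le> d \<and> (\<exists>u\<in>ipow J (d - e). \<exists>w\<in>gspan J Y d. v' = u \<otimes> y \<oplus> w)"
      then obtain u w where u: "u \<in> ipow J (d - e)" "w \<in> gspan J Y d" "v' = u \<otimes> y \<oplus> w" by blast
      then have "u' \<otimes> y' \<oplus> v' = (u' \<oplus> u) \<otimes> y \<oplus> w"
        using True c wc uc y by (simp add: l_distr a_assoc)
      moreover have "u' \<oplus> u \<in> ipow J (d - e)"
        using True u(1) step.hyps(3)
        by (simp add: additive_subgroup.a_closed[OF ideal.axioms(1)[OF ipow_ideal[OF J]]])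
      moreover have "e \<le> d" using True step.hyps by auto
      ultimately show ?thesis using u(2) by blast
    qed
  next
    case False
    then have Y': "(e', y') \<in> Y" using step by auto
    from step.IH show ?thesis
    proof
      assume "v' \<in> gspan J Y d"
      then show ?thesis using gspan.step[OF Y' step.hyps(2,3)] by blast
    next
      assume "e \<le> d \<and> (\<exists>u\<in>ipow J (d - e). \<exists>w\<in>gspan J Y d. v' = u \<otimes> y \<oplus> w)"
      then obtain u w where u: "e \<le> d" "u \<in> ipow J (d - e)" "w \<in> gspan J Y d" "v' = u \<otimes> y \<oplus> w" by blast
      then have "u' \<otimes> y' \<oplus> v' = u \<otimes> y \<oplus> (u' \<otimes> y' \<oplus> w)"
        using c wc uc y by (simp add: a_ac)
      moreover have "u' \<otimes> y' \<oplus> w \<in> gspan J Y d" using gspan.step[OF Y' step.hyps(2,3) u(3)] .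
      ultimately show ?thesis using u by blast
    qed
  qed
qed

section \<open>Polynomials in one element\<close>

text \<open>The elements \<open>z^i t^i\<close> with \<open>i < m\<close>. Their span in degree
  \<open>d\<close> consists of the values of polynomials in \<open>z\<close> of degree below
  \<open>m\<close> whose coefficient of \<open>z^i\<close> lies in \<open>ipow J (d - i)\<close>;
  terms with \<open>i > d\<close> are absent.\<close>

abbreviation powers :: "'a \<Rightarrow> nat \<Rightarrow> (nat \<times> 'a) set"
  where "powers z m \<equiv> (\<lambda>i. (i, z [^] i)) ` {..<m}"

lemma powers_closed: "z \<in> carrier R \<Longrightarrow> snd ` powers z m \<subseteq> carrier R"
  by auto

lemma gspan_powers_shift:
  assumes J: "ideal J R" and z: "z \<in> carrier R" and v: "v \<in> gspan J (powers z m) d"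
  shows "v \<otimes> z [^] j \<in> gspan J (powers z (m + j)) (d + j)"
proof (rule gspan_subst[OF J powers_closed[OF z] powers_closed[OF z] _ _ J v])
  fix e y u assume *: "(e, y) \<in> powers z m" "e \<le> d" "u \<in> ipow J (d - e)"
  then have "(e + j, y \<otimes> z [^] j) \<in> powers z (m + j)"
    using z by (auto simp: nat_pow_mult)
  then show "u \<otimes> (y \<otimes> z [^] j) \<in> gspan J (powers z (m + j)) (d + j)"
    using * by (intro gspan_gen[OF J powers_closed[OF z]]) auto
qed (use z in simp)

lemma gspan_powers_mono:
  "m \<le> n \<Longrightarrow> v \<in> gspan J (powers z m) d \<Longrightarrow> v \<in> gspan J (powers z n) d"
  by (rule gspan_mono[of "powers z m"]) auto

text \<open>Every factor from \<open>K\<close> is \<open>j \<oplus> r \<otimes> z\<close>. Expanding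
  a product of \<open>d\<close> such factors leaves \<open>d - i\<close> factors from
  \<open>J\<close> in front of \<open>z [^] i\<close>.\<close>

lemma ipow_expand_powers:
  assumes J: "ideal J R" and z: "z \<in> carrier R"
    and K: "ideal K R" and K_dec: "\<And>k. k \<in> K \<Longrightarrow> \<exists>j\<in>J. \<exists>r\<in>carrier R. k = j \<oplus> r \<otimes> z"
    and y: "y \<in> ipow K d"
  shows "y \<in> gspan J (powers z (Suc d)) d"
  using y
proof (induction d arbitrary: y)
  case 0
  then have "y \<otimes> z [^] (0::nat) \<in> gspan J (powers z (Suc 0)) 0"
    using z by (intro gspan_gen[OF J powers_closed[OF z], of 0]) auto
  then show ?case using 0 by simp
next
  case (Suc d)
  note add = gspan_add[OF J powers_closed[OF z]]
  have "y \<in> ideal_prod R (ipow K d) K" using Suc.prems by simp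
  then show ?case
  proof induction
    case (prod u k)
    obtain j r where jr: "j \<in> J" "r \<in> carrier R" "k = j \<oplus> r \<otimes> z" using K_dec prod(2) by blast
    have u: "u \<in> gspan J (powers z (Suc d)) d" using Suc.IH prod(1) .
    have c: "u \<in> carrier R" "j \<in> carrier R"
      using gspan_closed[OF J powers_closed[OF z] u] jr(1) J ideal.Icarr by auto
    \<comment> \<open>The degree grows by one in two ways: through the coefficient for
      \<open>j\<close>, through the power of \<open>z\<close> for
      \<open>r \<otimes> z\<close>.\<close>
    have "u \<otimes> j \<in> gspan J (powers z (Suc d)) (d + 1)"
      using jr(1) ipow_1[OF J] by (intro gspan_smult[OF J powers_closed[OF z] _ u]) simp
    then have 1: "u \<otimes> j \<in> gspan J (powers z (Suc (Suc d))) (Suc d)"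
      using gspan_powers_mono[of "Suc d" "Suc (Suc d)"] by simp
    have "u \<otimes> r \<in> gspan J (powers z (Suc d)) (d + 0)"
      using jr(2) by (intro gspan_smult[OF J powers_closed[OF z] _ u]) simp
    then have "u \<otimes> r \<otimes> z [^] (1::nat) \<in> gspan J (powers z (Suc d + 1)) (d + 0 + 1)"
      by (rule gspan_powers_shift[OF J z])
    then have 2: "u \<otimes> r \<otimes> z \<in> gspan J (powers z (Suc (Suc d))) (Suc d)" using z by simp
    have "u \<otimes> k = u \<otimes> j \<oplus> u \<otimes> r \<otimes> z" using c jr z by (simp add: r_distr m_assoc)
    then show ?case using add[OF 1 2] by simp
  next
    case (sum s1 s2)
    show ?case by (rule add[OF sum.IH])
  qed
qed

text \<open>\<open>A\<close> collects leading coefficients of elements of \<open>B\<close>, regarded as polynomials in \<open>z\<close>.\<close>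

lemma gspan_leading_coeff:
  assumes J: "ideal J R" and z: "z \<in> carrier R" and K: "ideal K R" and JK: "J \<subseteq> K" and zK: "z \<in> K"
    and A: "snd ` A \<subseteq> carrier R" and B: "snd ` B \<subseteq> carrier R"
    and lead: "\<And>f a. (f, a) \<in> A \<Longrightarrow>
      \<exists>i\<le>m. \<exists>w\<in>gspan J (powers z i) (f + i). (f + i, a \<otimes> z [^] i \<oplus> w) \<in> B"
    and v: "v \<in> gspan J A f"
  shows "\<exists>v'\<in>gspan J (powers z m) (f + m). v \<otimes> z [^] m \<oplus> v' \<in> gspan K B (f + m)"
  using v
proof induction
  case zero
  show ?case using z gspan.zero by (intro bexI[of _ \<zero>]) auto
next
  case (step e a u t)
  obtain t' where t': "t' \<in> gspan J (powers z m) (f + m)" "t \<otimes> z [^] m \<oplus> t' \<in> gspan K B (f + m)"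
    using step.IH by blast
  obtain i w where i: "i \<le> m" and w: "w \<in> gspan J (powers z i) (e + i)"
    and b: "(e + i, a \<otimes> z [^] i \<oplus> w) \<in> B"
    using lead[OF step.hyps(1)] by blast
  \<comment> \<open>\<open>k\<close> is the power of \<open>z\<close> that raises the chosen element
    of \<open>B\<close> from z-degree \<open>i\<close> to z-degree \<open>m\<close>.\<close>
  define k where "k = m - i"
  have m: "m = i + k" using i by (simp add: k_def)
  have c: "a \<in> carrier R" "u \<in> carrier R" "t \<in> carrier R" "t' \<in> carrier R" "w \<in> carrier R" "z [^] i \<in> carrier R" "z [^] k \<in> carrier R"
    using A step.hyps ipow_closed[OF J] gspan_closed[OF J A] gspan_closed[OF J powers_closed[OF z]]
      t' w z by auto
  have "w \<otimes> z [^] k \<otimes> u \<in> gspan J (powers z (i + k)) (e + i + k + (f - e))"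
    using step.hyps(3) by (rule gspan_smult[OF J powers_closed[OF z] _ gspan_powers_shift[OF J z w]])
  then have 1: "w \<otimes> z [^] k \<otimes> u \<oplus> t' \<in> gspan J (powers z m) (f + m)"
    using step.hyps(2) t'(1) m by (intro gspan_add[OF J powers_closed[OF z]]) (simp_all add: add_ac)
  \<comment> \<open>The coefficient \<open>u\<close> lies in a power of \<open>J\<close>, but
    \<open>z [^] k\<close> only in a power of \<open>K\<close>; therefore the span of
    \<open>B\<close> is taken over \<open>K\<close>.\<close>
  have "u \<otimes> z [^] k \<in> ipow K (f - e + k)"
    using step.hyps(3) ipow_mono[OF JK] nat_pow_in_ipow[OF K zK] by (intro ipow_mult[OF K]) auto
  then have "(u \<otimes> z [^] k) \<otimes> (a \<otimes> z [^] i \<oplus> w) \<in> gspan K B (f + m)"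
    using step.hyps(2) m by (intro gspan_gen[OF K B b]) (simp_all add: add_ac)
  from gspan_add[OF K B this t'(2)]
  have 2: "(u \<otimes> z [^] k) \<otimes> (a \<otimes> z [^] i \<oplus> w) \<oplus> (t \<otimes> z [^] m \<oplus> t') \<in> gspan K B (f + m)" .
  have "(u \<otimes> z [^] k) \<otimes> (a \<otimes> z [^] i \<oplus> w) = (u \<otimes> a) \<otimes> z [^] m \<oplus> w \<otimes> z [^] k \<otimes> u"
    using c z unfolding m by (simp add: r_distr nat_pow_mult[symmetric] m_ac)
  then have "(u \<otimes> z [^] k) \<otimes> (a \<otimes> z [^] i \<oplus> w) \<oplus> (t \<otimes> z [^] m \<oplus> t')
      = (u \<otimes> a \<oplus> t) \<otimes> z [^] m \<oplus> (w \<otimes> z [^] k \<otimes> u \<oplus> t')"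
    using c z by (simp add: l_distr a_ac)
  then show ?case using 1 2 by auto
qed

section \<open>Noetherianity of the Rees algebra of an ideal\<close>

text \<open>The Noetherian property for homogeneous ideals of the Rees algebra: any homogeneous
  generating set contains a finite one.\<close>

definition rees_noetherian :: "'a set \<Rightarrow> bool"
  where "rees_noetherian J \<longleftrightarrow> (\<forall>Y. (\<forall>(d, y)\<in>Y. y \<in> ipow J d) \<longrightarrow>
    (\<exists>Y0\<subseteq>Y. finite Y0 \<and> (\<forall>(d, y)\<in>Y. y \<in> gspan J Y0 d)))"

text \<open>The positive powers of the zero ideal vanish, so everything happens in degree
  \<open>0\<close>, where the Noetherian property of \<open>R\<close> applies.\<close>

lemma rees_noetherian_zero:
  assumes "noetherian_ring R"
  shows "rees_noetherian {\<zero>}"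
  unfolding rees_noetherian_def
proof (intro allI impI)
  fix Y assume Y: "\<forall>(d, y)\<in>Y. y \<in> ipow {\<zero>} d"
  have Yc: "snd ` Y \<subseteq> carrier R" using Y ipow_closed[OF zeroideal] by auto
  let ?H = "gspan {\<zero>} Y 0"
  have H: "ideal ?H R" by (rule gspan_ideal[OF zeroideal Yc])
  then obtain A where A: "A \<subseteq> carrier R" "finite A" "?H = Idl A"
    using noetherian_ring.finetely_gen[OF assms] by blast
  then have "A \<subseteq> ?H" using genideal_self by simp
  then obtain Y0 where Y0: "Y0 \<subseteq> Y" "finite Y0" "\<forall>(d, a)\<in>Pair 0 ` A. a \<in> gspan {\<zero>} Y0 d"
    using gspan_finite_supports[of "Pair 0 ` A" "{\<zero>}" Y] A(2) by blast
  have Y0c: "snd ` Y0 \<subseteq> carrier R" using Y0(1) Yc by blast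
  have H0: "?H \<subseteq> gspan {\<zero>} Y0 0"
    using Y0(3) genideal_minimal[OF gspan_ideal[OF zeroideal Y0c], of A 0] A(3) by (simp add: subset_iff)
  have "y \<in> gspan {\<zero>} Y0 d" if dy: "(d, y) \<in> Y" for d y
  proof (cases d)
    case 0
    then show ?thesis using gspan_base[OF zeroideal Yc] dy H0 by blast
  next
    case (Suc n)
    then have "y \<in> ideal_prod R (ipow {\<zero>} n) {\<zero>}" using Y dy by auto
    then have "y = \<zero>" using ideal_prod_zero ipow_ideal[OF zeroideal] by blast
    then show ?thesis by (simp add: gspan.zero)
  qed
  then show "\<exists>Y0\<subseteq>Y. finite Y0 \<and> (\<forall>(d, y)\<in>Y. y \<in> gspan {\<zero>} Y0 d)" using Y0 by blast
qed

text \<open>Hilbert's basis theorem: the Rees algebra of \<open>K\<close> is generated over that of \<open>J\<close> by \<open>z t\<close>, and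
  \<open>L m\<close> consists of the leading coefficients of the elements of \<open>z\<close>-degree at most \<open>m\<close>.\<close>

lemma rees_noetherian_extend:
  assumes J: "ideal J R" and z: "z \<in> carrier R" and K: "ideal K R" and JK: "J \<subseteq> K" and zK: "z \<in> K"
    and K_dec: "\<And>k. k \<in> K \<Longrightarrow> \<exists>j\<in>J. \<exists>r\<in>carrier R. k = j \<oplus> r \<otimes> z"
    and noeth: "rees_noetherian J"
  shows "rees_noetherian K"
  unfolding rees_noetherian_def
proof (intro allI impI)
  fix Y assume Y: "\<forall>(d, y)\<in>Y. y \<in> ipow K d"
  have Yc: "snd ` Y \<subseteq> carrier R" using Y ipow_closed[OF K] by auto
  define G where "G = gspan K Y"
  \<comment> \<open>The pair records the degree \<open>f\<close> of the coefficient; the element of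
    \<open>G\<close> itself has degree \<open>f + m\<close>, since \<open>z [^] m\<close> carries
    degree \<open>m\<close>.\<close>
  define L where "L m = {(f, a). a \<in> ipow J f \<and>
    (\<exists>w\<in>gspan J (powers z m) (f + m). a \<otimes> z [^] m \<oplus> w \<in> G (f + m))}" for m :: nat
  have G: "ideal (G d) R" for d unfolding G_def by (rule gspan_ideal[OF K Yc])
  have gen: "\<exists>A\<subseteq>Z. finite A \<and> (\<forall>(f, a)\<in>Z. a \<in> gspan J A f)" if "Z \<subseteq> (\<Union>m. L m)" for Z
  proof -
    have "\<forall>(f, a)\<in>Z. a \<in> ipow J f" using that by (fastforce simp: L_def)
    then show ?thesis using noeth unfolding rees_noetherian_def by blast
  qed
  have "\<forall>m. \<exists>A\<subseteq>L m. finite A \<and> (\<forall>(f, a)\<in>L m. a \<in> gspan J A f)" by (intro allI gen) blast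
  then obtain A where A: "\<And>m. A m \<subseteq> L m" "\<And>m. finite (A m)"
    and A_gen: "\<And>m f a. (f, a) \<in> L m \<Longrightarrow> a \<in> gspan J (A m) f"
    by (metis (no_types, lifting) case_prodD)
  \<comment> \<open>\<open>A'\<close> generates all the \<open>L m\<close> at once. Its elements
    occur at z-degrees at most \<open>M\<close>, so \<open>A'\<close> serves every
    \<open>m \<ge> M\<close>, and only the finitely many sets \<open>A m\<close> with
    \<open>m < M\<close> have to be added.\<close>
  obtain A' where A': "A' \<subseteq> (\<Union>m. L m)" "finite A'"
    and A'_gen: "\<And>m f a. (f, a) \<in> L m \<Longrightarrow> a \<in> gspan J A' f"
    using gen[of "\<Union>m. L m"] by blast
  obtain \<mu> where \<mu>: "\<And>x. x \<in> A' \<Longrightarrow> x \<in> L (\<mu> x)" using A'(1) by (metis UN_iff subsetD)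
  obtain M where M: "\<And>x. x \<in> A' \<Longrightarrow> \<mu> x \<le> M"
    using A'(2) finite_nat_set_iff_bounded_le[of "\<mu> ` A'"] by auto
  have "\<forall>m x. \<exists>w. x \<in> L m \<longrightarrow> w \<in> gspan J (powers z m) (fst x + m) \<and>
      snd x \<otimes> z [^] m \<oplus> w \<in> G (fst x + m)"
    by (auto simp: L_def)
  then obtain wit where wit: "\<And>m x. x \<in> L m \<Longrightarrow> wit m x \<in> gspan J (powers z m) (fst x + m)"
      "\<And>m x. x \<in> L m \<Longrightarrow> snd x \<otimes> z [^] m \<oplus> wit m x \<in> G (fst x + m)"
    by metis
  \<comment> \<open>For \<open>x\<close> in \<open>L m\<close>, this lifts the leading coefficient
    \<open>snd x\<close> to an element of \<open>G\<close>; \<open>wit m x\<close> is its part of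
    lower z-degree.\<close>
  define elt where "elt m x = (fst x + m, snd x \<otimes> z [^] m \<oplus> wit m x)" for m x
  define B where "B = (\<Union>m<M. elt m ` A m) \<union> (\<lambda>x. elt (\<mu> x) x) ` A'"
  have "finite B" using A(2) A'(2) by (simp add: B_def)
  have eltG: "snd (elt m x) \<in> G (fst (elt m x))" if "x \<in> L m" for m x
    using wit(2)[OF that] by (simp add: elt_def)
  have "snd b \<in> G (fst b)" if "b \<in> B" for b
    using that eltG A(1) \<mu> unfolding B_def by blast
  then have BG: "v \<in> G d" if "(d, v) \<in> B" for d v
    using that by fastforce
  have Bc: "snd ` B \<subseteq> carrier R" proof safe
    fix d v assume "(d, v) \<in> B"
    then show "snd (d, v) \<in> carrier R" using ideal.Icarr[OF G BG] by simp
  qed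
  obtain Y0 where Y0: "Y0 \<subseteq> Y" "finite Y0" and BY0: "\<forall>(d, v)\<in>B. v \<in> gspan K Y0 d"
    using gspan_finite_supports[OF \<open>finite B\<close> BG[unfolded G_def]] by blast
  have Y0c: "snd ` Y0 \<subseteq> carrier R" using Y0(1) Yc by blast
  \<comment> \<open>Division by \<open>B\<close>, by induction on a strict bound for the z-degree:
    subtracting an element spanned by \<open>B\<close> removes the leading term.\<close>
  have span_B: "v \<in> gspan K B d" if "v \<in> G d" "v \<in> gspan J (powers z m) d" for v d m
    using that
  proof (induction m arbitrary: v)
    case 0
    \<comment> \<open>\<open>powers z 0\<close> is empty and spans only
      \<open>\<zero>\<close>.\<close>
    then show ?case by (auto elim!: gspan.cases intro: gspan.zero)
  next
    case (Suc m)
    have "powers z (Suc m) = insert (m, z [^] m) (powers z m)" by (simp add: lessThan_Suc)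
    then consider "v \<in> gspan J (powers z m) d"
      | a w where "m \<le> d" "a \<in> ipow J (d - m)" "w \<in> gspan J (powers z m) d" "v = a \<otimes> z [^] m \<oplus> w"
      using gspan_insert_cases[OF J powers_closed[OF z], of "z [^] m" v m m d] Suc.prems(2) z by auto
    then show ?case
    proof cases
      case 1
      then show ?thesis using Suc by blast
    next
      case 2
      have aL: "(d - m, a) \<in> L m" using 2 Suc.prems(1) by (auto simp: L_def)
      define A0 where "A0 = (if m < M then A m else A')"
      have a: "a \<in> gspan J A0 (d - m)" using A_gen A'_gen aL by (simp add: A0_def)
      have A0c: "snd ` A0 \<subseteq> carrier R"
      proof safe
        fix f b assume "(f, b) \<in> A0"
        then have "(f, b) \<in> (\<Union>m. L m)" using A(1) A'(1) by (auto simp: A0_def split: if_splits)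
        then show "snd (f, b) \<in> carrier R" using ipow_closed[OF J] by (auto simp: L_def)
      qed
      have lead: "\<exists>i\<le>m. \<exists>w\<in>gspan J (powers z i) (f + i). (f + i, b \<otimes> z [^] i \<oplus> w) \<in> B"
        if fb: "(f, b) \<in> A0" for f b
      proof -
        obtain i where i: "i \<le> m" "(f, b) \<in> L i" "elt i (f, b) \<in> B"
        proof (cases "m < M")
          case True
          then have "(f, b) \<in> A m" using fb by (simp add: A0_def)
          then show thesis using True A(1) by (intro that[of m]) (auto simp: B_def)
        next
          case False
          then have "(f, b) \<in> A'" using fb by (simp add: A0_def)
          then show thesis using False \<mu> M[of "(f, b)"] by (intro that[of "\<mu> (f, b)"]) (auto simp: B_def)
        qed
        then show ?thesis using wit(1)[OF i(2)] unfolding elt_def by auto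
      qed
      \<comment> \<open>An element spanned by \<open>B\<close> with the same leading term as
        \<open>v\<close>.\<close>
      obtain v' where v': "v' \<in> gspan J (powers z m) d" "a \<otimes> z [^] m \<oplus> v' \<in> gspan K B d"
        using gspan_leading_coeff[OF J z K JK zK A0c Bc lead a] 2(1) by auto
      define t where "t = a \<otimes> z [^] m \<oplus> v'"
      have "gspan K B d \<subseteq> G d"
        using gspan_trans[OF K Bc Yc] BG unfolding G_def by blast
      then have "v \<ominus> t \<in> G d" using Suc.prems(1) v'(2) ideal_minus_closed[OF G] by (auto simp: t_def)
      have c: "a \<in> carrier R" "v' \<in> carrier R" "w \<in> carrier R"
        using ipow_closed[OF J 2(2)] gspan_closed[OF J powers_closed[OF z]] v'(1) 2(3) by auto
      have "v \<ominus> t = w \<ominus> v'"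
      proof -
        define s where "s = a \<otimes> z [^] m"
        have s: "s \<in> carrier R" using c z by (simp add: s_def)
        then have "s \<oplus> w \<ominus> (s \<oplus> v') = (s \<oplus> \<ominus> s) \<oplus> (w \<ominus> v')"
          using c by (simp add: a_minus_def minus_add a_ac)
        then show ?thesis using c s by (simp add: 2(4) t_def s_def r_neg)
      qed
      also have "\<dots> \<in> gspan J (powers z m) d"
        using 2(3) v'(1) ideal_minus_closed[OF gspan_ideal[OF J powers_closed[OF z]]] by blast
      finally have "v \<ominus> t \<in> gspan K B d" using Suc.IH \<open>v \<ominus> t \<in> G d\<close> by blast
      then have "(v \<ominus> t) \<oplus> t \<in> gspan K B d" using v'(2) gspan_add[OF K Bc] by (simp add: t_def)
      moreover have "v \<in> carrier R" "t \<in> carrier R" using c z by (simp_all add: 2(4) t_def)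
      then have "(v \<ominus> t) \<oplus> t = v" by (simp add: a_minus_def a_assoc l_neg)
      ultimately show ?thesis by simp
    qed
  qed
  \<comment> \<open>An element of degree \<open>d\<close> has z-degree at most \<open>d\<close>, so
    \<open>span_B\<close> applies to it; then \<open>B\<close> is expressed through
    \<open>Y0\<close>.\<close>
  have "y \<in> gspan K Y0 d" if dy: "(d, y) \<in> Y" for d y
  proof -
    have "y \<in> gspan J (powers z (Suc d)) d"
      using Y dy by (intro ipow_expand_powers[OF J z K K_dec]) auto
    then have "y \<in> gspan K B d"
      using span_B gspan_base[OF K Yc dy] unfolding G_def by blast
    then show ?thesis using gspan_trans[OF K Bc Y0c] BY0 by blast
  qed
  then show "\<exists>Y0\<subseteq>Y. finite Y0 \<and> (\<forall>(d, y)\<in>Y. y \<in> gspan K Y0 d)" using Y0 by blast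
qed

text \<open>A finite generating set of \<open>J\<close> is built up from the empty set, one
  generator \<open>z\<close> at a time.\<close>

lemma rees_noetherian_ideal:
  assumes "noetherian_ring R" "ideal J R"
  shows "rees_noetherian J"
proof -
  have *: "rees_noetherian (Idl A)" if "finite A" "A \<subseteq> carrier R" for A
    using that
  proof (induction A)
    case empty
    have "Idl {} = {\<zero>}"
      using genideal_minimal[OF zeroideal, of "{}"] genideal_ideal[of "{}"]
        additive_subgroup.zero_closed[OF ideal.axioms(1)] by blast
    then show ?case using rees_noetherian_zero[OF assms(1)] by simp
  next
    case (insert z A)
    let ?J = "Idl A" and ?K = "Idl (insert z A)"
    have z: "z \<in> carrier R" and A: "A \<subseteq> carrier R" using insert.prems by auto
    have J: "ideal ?J R" and K: "ideal ?K R" using A z by (auto intro: genideal_ideal)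
    have AK: "insert z A \<subseteq> ?K" using A z by (intro genideal_self) auto
    have "A \<subseteq> ?J <+> PIdl z" "z \<in> ?J <+> PIdl z"
    proof -
      have "\<zero> \<in> ?J" "\<zero> \<in> PIdl z"
        using J cgenideal_ideal[OF z] additive_subgroup.zero_closed[OF ideal.axioms(1)] by auto
      then show "A \<subseteq> ?J <+> PIdl z" "z \<in> ?J <+> PIdl z"
        using genideal_self[OF A] cgenideal_self[OF z] A z unfolding set_add_def' by force+
    qed
    then have "?K \<subseteq> ?J <+> PIdl z"
      using genideal_minimal[OF add_ideals[OF J cgenideal_ideal[OF z]]] by blast
    then have dec: "\<exists>j\<in>?J. \<exists>r\<in>carrier R. k = j \<oplus> r \<otimes> z" if "k \<in> ?K" for k
      using that unfolding set_add_def' cgenideal_def by blast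
    show ?case
      using rees_noetherian_extend[OF J z K _ _ dec] insert.IH A AK genideal_minimal[OF K] by blast
  qed
  then show ?thesis using noetherian_ring.finetely_gen[OF assms] by auto
qed

section \<open>Tight and integral closure\<close>

text \<open>If \<open>g\<close> is not nilpotent, Zorn's lemma gives a maximal multiplicative set
  \<open>W\<close> with \<open>g\<close> in it and without \<open>\<zero>\<close>. Its complement is
  a minimal prime, so \<open>c\<close> lies in \<open>W\<close>, and then so does
  \<open>c \<otimes> g = \<zero>\<close>.\<close>

lemma nilpotent_if_annihilated:
  fixes p :: nat
  assumes p: "prime p" "[p] \<cdot> \<one> = \<zero>"
    and c: "c \<in> carrier R" "\<And>P. minimal_prime R P \<Longrightarrow> c \<notin> P"
    and g: "g \<in> carrier R" "c \<otimes> g = \<zero>"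
  shows "\<exists>s::nat. g [^] s = \<zero>"
proof (rule ccontr)
  assume "\<nexists>s::nat. g [^] s = \<zero>"
  then have g_pow: "g [^] s \<noteq> \<zero>" for s :: nat by blast
  define MS where "MS W \<longleftrightarrow> W \<subseteq> carrier R \<and> \<one> \<in> W \<and> \<zero> \<notin> W \<and> (\<forall>a\<in>W. \<forall>b\<in>W. a \<otimes> b \<in> W)" for W
  have "MS (range (\<lambda>n::nat. g [^] n))"
    unfolding MS_def
  proof (intro conjI ballI)
    show "\<one> \<in> range (\<lambda>n::nat. g [^] n)" by (metis nat_pow_0 rangeI)
    show "\<zero> \<notin> range (\<lambda>n::nat. g [^] n)" using g_pow by (metis (full_types) imageE)
  qed (use g in \<open>auto simp: nat_pow_mult\<close>)
  moreover have "g \<in> range (\<lambda>n::nat. g [^] n)" using g by (metis nat_pow_eone rangeI)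
  ultimately have "{W. MS W \<and> g \<in> W} \<noteq> {}" by blast
  moreover have "\<Union>\<C> \<in> {W. MS W \<and> g \<in> W}"
    if "\<C> \<noteq> {}" "subset.chain {W. MS W \<and> g \<in> W} \<C>" for \<C>
  proof -
    have C: "MS W" "g \<in> W" if "W \<in> \<C>" for W
      using that \<open>subset.chain _ \<C>\<close> unfolding subset.chain_def by auto
    have "a \<otimes> b \<in> \<Union>\<C>" if ab: "a \<in> \<Union>\<C>" "b \<in> \<Union>\<C>" for a b
    proof -
      obtain V W where VW: "V \<in> \<C>" "W \<in> \<C>" "a \<in> V" "b \<in> W" using ab by blast
      then have "V \<subseteq> W \<or> W \<subseteq> V" using \<open>subset.chain _ \<C>\<close> by (meson subset_chain_def)
      then show ?thesis using VW C(1) unfolding MS_def by blast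
    qed
    then show ?thesis using C \<open>\<C> \<noteq> {}\<close> unfolding MS_def by blast
  qed
  \<comment> \<open>Sets above \<open>W\<close> contain \<open>g\<close> automatically, so
    \<open>W\<close> is maximal among all sets with \<open>MS\<close>.\<close>
  ultimately obtain W where W: "MS W" "g \<in> W" and W_max: "\<And>X. MS X \<Longrightarrow> W \<subseteq> X \<Longrightarrow> X = W"
    using subset_Zorn_nonempty[of "{W. MS W \<and> g \<in> W}"] by (smt (verit) mem_Collect_eq subsetD)
  have Wc: "w \<in> carrier R" if "w \<in> W" for w using W that by (auto simp: MS_def)
  have W_mult: "a \<otimes> b \<in> W" if "a \<in> W" "b \<in> W" for a b using W that by (auto simp: MS_def)
  have W01: "\<zero> \<notin> W" "\<one> \<in> W" using W by (auto simp: MS_def)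
  have W_pow: "a [^] n \<in> W" if "a \<in> W" for a and n :: nat
    using that by (induction n) (auto simp: W01 W_mult)
  \<comment> \<open>Otherwise the multiplicative set \<open>X\<close> generated by \<open>W\<close>
    and \<open>a\<close> would avoid \<open>\<zero>\<close> and be larger than
    \<open>W\<close>.\<close>
  have kill: "\<exists>w\<in>W. \<exists>n::nat. w \<otimes> a [^] n = \<zero>" if a: "a \<in> carrier R" "a \<notin> W" for a
  proof (rule ccontr)
    assume no: "\<not> ?thesis"
    define X where "X = {w \<otimes> a [^] n | w n. w \<in> W \<and> n \<in> (UNIV :: nat set)}"
    have XI: "w \<otimes> a [^] n \<in> X" if "w \<in> W" for w and n :: nat using that by (auto simp: X_def)
    have "\<one> \<in> X" using XI[OF W01(2), of 0] by simp
    moreover have "x \<otimes> y \<in> X" if xy: "x \<in> X" "y \<in> X" for x y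
    proof -
      obtain w n v m where *: "w \<in> W" "v \<in> W" "x = w \<otimes> a [^] (n::nat)" "y = v \<otimes> a [^] (m::nat)"
        using xy by (auto simp: X_def)
      then have "x \<otimes> y = (w \<otimes> v) \<otimes> a [^] (n + m)"
        using a Wc by (simp add: nat_pow_mult[symmetric] m_ac)
      then show ?thesis using XI W_mult * by simp
    qed
    moreover have "\<zero> \<notin> X"
    proof
      assume "\<zero> \<in> X"
      then obtain w and n :: nat where "w \<in> W" "w \<otimes> a [^] n = \<zero>" by (auto simp: X_def)
      then show False using no by blast
    qed
    moreover have "X \<subseteq> carrier R" using Wc a by (auto simp: X_def)
    ultimately have "MS X" by (simp add: MS_def)
    moreover have "W \<subseteq> X"
    proof
      fix w assume "w \<in> W"
      then show "w \<in> X" using XI[of w 0] Wc by simp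
    qed
    ultimately have "X = W" by (rule W_max)
    moreover have "a \<in> X" using XI[OF W01(2), of 1] a by simp
    ultimately show False using a by simp
  qed
  define P where "P = carrier R - W"
  have P_mult: "r \<otimes> a \<in> P" if a: "a \<in> P" and r: "r \<in> carrier R" for a r
  proof (rule ccontr)
    assume "r \<otimes> a \<notin> P"
    then have "r \<otimes> a \<in> W" using a r by (auto simp: P_def)
    obtain w n where w: "w \<in> W" "w \<otimes> a [^] (n::nat) = \<zero>" using kill[of a] a by (auto simp: P_def)
    have "w \<otimes> (r \<otimes> a) [^] n = (w \<otimes> a [^] n) \<otimes> r [^] n"
      using Wc[OF w(1)] a r by (simp add: P_def nat_pow_distrib m_ac)
    also have "\<dots> = \<zero>" using w r by simp
    finally show False using W_mult[OF w(1) W_pow[OF \<open>r \<otimes> a \<in> W\<close>, of n]] W01 by simp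
  qed
  have P_add: "a \<oplus> b \<in> P" if a: "a \<in> P" and b: "b \<in> P" for a b
  proof (rule ccontr)
    assume "a \<oplus> b \<notin> P"
    then have ab: "a \<oplus> b \<in> W" using a b by (auto simp: P_def)
    have c: "a \<in> carrier R" "b \<in> carrier R" using a b by (auto simp: P_def)
    obtain w n where w: "w \<in> W" "w \<otimes> a [^] (n::nat) = \<zero>" using kill[of a] a by (auto simp: P_def)
    obtain v m where v: "v \<in> W" "v \<otimes> b [^] (m::nat) = \<zero>" using kill[of b] b by (auto simp: P_def)
    \<comment> \<open>A power of \<open>p\<close>, so that the Frobenius map splits the sum, and
      large enough for both summands to be annihilated.\<close>
    define q where "q = p ^ (n + m)"
    have "n + m < q" unfolding q_def using p(1) prime_gt_1_nat power_gt_expt by simp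
    then obtain i j where ij: "q = n + i" "q = m + j" by (metis add.commute add_leD1 add_leD2 le_Suc_ex less_imp_le)
    have "w \<otimes> a [^] q = (w \<otimes> a [^] n) \<otimes> a [^] i"
      using c Wc[OF w(1)] by (simp add: ij(1) nat_pow_mult[symmetric] m_assoc)
    then have 1: "w \<otimes> a [^] q = \<zero>" using w c by simp
    have "v \<otimes> b [^] q = (v \<otimes> b [^] m) \<otimes> b [^] j"
      using c Wc[OF v(1)] by (simp add: ij(2) nat_pow_mult[symmetric] m_assoc)
    then have 2: "v \<otimes> b [^] q = \<zero>" using v c by simp
    have "(a \<oplus> b) [^] q = a [^] q \<oplus> b [^] q"
      using frobenius_power_add[OF p c] by (simp add: q_def)
    then have "(w \<otimes> v) \<otimes> (a \<oplus> b) [^] q = v \<otimes> (w \<otimes> a [^] q) \<oplus> w \<otimes> (v \<otimes> b [^] q)"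
      using c Wc[OF w(1)] Wc[OF v(1)] by (simp add: r_distr m_ac)
    also have "\<dots> = \<zero>" using 1 2 Wc[OF w(1)] Wc[OF v(1)] by simp
    finally show False using W_mult[OF W_mult[OF w(1) v(1)] W_pow[OF ab, of q]] W01 by simp
  qed
  have "ideal P R"
    using P_add P_mult W01 by (intro idealI_cring) (auto simp: P_def)
  then have "primeideal P R"
    using W01 W_mult by (intro primeidealI is_cring) (auto simp: P_def)
  \<comment> \<open>The complement of a prime inside \<open>P\<close> is a multiplicative set above
    \<open>W\<close>, hence equal to \<open>W\<close>.\<close>
  moreover have "Q = P" if Q: "primeideal Q R" "Q \<subseteq> P" for Q
  proof -
    interpret Q: primeideal Q R by (rule Q)
    have "\<one> \<notin> Q" using Q.one_imp_carrier Q.I_notcarr by blast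
    then have "MS (carrier R - Q)"
      unfolding MS_def using Q.I_prime by auto
    moreover have "W \<subseteq> carrier R - Q" using Q(2) Wc by (auto simp: P_def)
    ultimately have "carrier R - Q = W" by (rule W_max)
    then show ?thesis using Q.a_subset by (auto simp: P_def)
  qed
  ultimately have "minimal_prime R P" unfolding minimal_prime_def by blast
  then have "c \<in> W" using c by (auto simp: P_def)
  then show False using W_mult[of c g] W(2) g(2) W01 by simp
qed

section \<open>Integral equations\<close>

text \<open>Collects the terms with equal powers of \<open>x\<close> into the shape of an integral
  equation. The exponents \<open>e < n\<close> correspond to the indices \<open>n - e\<close> in
  \<open>{1..n}\<close>.\<close>

lemma gspan_powers_expansion:
  assumes J: "ideal J R" and x: "x \<in> carrier R" and v: "v \<in> gspan J (powers x n) n"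
  shows "\<exists>b. (\<forall>i\<in>{1..n}. b i \<in> ipow J i) \<and> v = (\<Oplus>i\<in>{1..n}. b i \<otimes> x [^] (n - i))"
  using v
proof induction
  case zero
  have "(\<Oplus>i\<in>{1..n}. \<zero> \<otimes> x [^] (n - i)) = \<zero>"
    using x by (intro add.finprod_one_eqI) auto
  moreover have "\<zero> \<in> ipow J i" for i
    using additive_subgroup.zero_closed[OF ideal.axioms(1)[OF ipow_ideal[OF J]]] .
  ultimately show ?case by (intro exI[of _ "\<lambda>_. \<zero>"]) auto
next
  case (step e y u v)
  then obtain b where b: "\<And>i. i \<in> {1..n} \<Longrightarrow> b i \<in> ipow J i" "v = (\<Oplus>i\<in>{1..n}. b i \<otimes> x [^] (n - i))"
    by blast
  have e: "e < n" "y = x [^] e" using step.hyps(1) by auto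
  define b' where "b' i = (if n - e = i then u else \<zero>)" for i
  have b': "b' i \<in> ipow J i" for i
    using step.hyps(3) additive_subgroup.zero_closed[OF ideal.axioms(1)[OF ipow_ideal[OF J]]]
    by (auto simp: b'_def)
  have bc: "b i \<in> carrier R" if "i \<in> {1..n}" for i using b(1) that ipow_closed[OF J] by blast
  have b'c: "b' i \<in> carrier R" for i using b' ipow_closed[OF J] by blast
  have "u \<in> carrier R" using step.hyps(3) ipow_closed[OF J] by blast
  have "(\<Oplus>i\<in>{1..n}. b' i \<otimes> x [^] (n - i)) = (\<Oplus>i\<in>{1..n}. if n - e = i then u \<otimes> x [^] (n - i) else \<zero>)"
    using x \<open>u \<in> carrier R\<close> by (intro finsum_cong') (auto simp: b'_def)
  also have "\<dots> = u \<otimes> x [^] (n - (n - e))"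
    using e x \<open>u \<in> carrier R\<close> by (intro finsum_singleton) auto
  also have "\<dots> = u \<otimes> y" using e by simp
  finally have "u \<otimes> y \<oplus> v = (\<Oplus>i\<in>{1..n}. b' i \<otimes> x [^] (n - i) \<oplus> b i \<otimes> x [^] (n - i))"
    using b(2) bc b'c x by (subst finsum_addf) auto
  also have "\<dots> = (\<Oplus>i\<in>{1..n}. (b' i \<oplus> b i) \<otimes> x [^] (n - i))"
    using bc b'c x by (intro finsum_cong') (auto simp: l_distr)
  finally have eq: "u \<otimes> y \<oplus> v = (\<Oplus>i\<in>{1..n}. (b' i \<oplus> b i) \<otimes> x [^] (n - i))" .
  have "\<forall>i\<in>{1..n}. b' i \<oplus> b i \<in> ipow J i"
    using b' b(1) additive_subgroup.a_closed[OF ideal.axioms(1)[OF ipow_ideal[OF J]]] by blast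
  with eq show ?case by (intro exI[of _ "\<lambda>i. b' i \<oplus> b i"]) blast
qed

text \<open>An integral equation of degree \<open>n\<close> expresses \<open>x [^] n\<close> by
  lower powers with coefficients in the matching powers of \<open>J\<close>; the sign is absorbed
  because the span is an ideal.\<close>

lemma integral_closure_iff:
  assumes J: "ideal J R"
  shows "x \<in> integral_closure R J \<longleftrightarrow> x \<in> carrier R \<and> (\<exists>n>0. x [^] n \<in> gspan J (powers x n) n)"
proof
  assume "x \<in> integral_closure R J"
  then obtain n b where x: "x \<in> carrier R" and n: "n > 0" and b: "\<And>i. i \<in> {1..n} \<Longrightarrow> b i \<in> ipow J i"
    and eq: "x [^] n \<oplus> (\<Oplus>i\<in>{1..n}. b i \<otimes> x [^] (n - i)) = \<zero>"
    unfolding integral_closure_def ipow_def by blast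
  let ?S = "\<Oplus>i\<in>{1..n}. b i \<otimes> x [^] (n - i)"
  have I: "ideal (gspan J (powers x n) n) R" by (rule gspan_ideal[OF J powers_closed[OF x]])
  have S: "?S \<in> gspan J (powers x n) n"
  proof (rule ideal_finsum_closed[OF I])
    fix i assume "i \<in> {1..n}"
    then show "b i \<otimes> x [^] (n - i) \<in> gspan J (powers x n) n"
      using b by (intro gspan_gen[OF J powers_closed[OF x], of "n - i"]) auto
  qed
  moreover have "x [^] n = \<ominus> ?S"
    using eq x ideal.Icarr[OF I S] minus_equality[of "x [^] n" ?S] by simp
  ultimately have "x [^] n \<in> gspan J (powers x n) n"
    using additive_subgroup.a_inv_closed[OF ideal.axioms(1)[OF I]] by simp
  then show "x \<in> carrier R \<and> (\<exists>n>0. x [^] n \<in> gspan J (powers x n) n)" using x n by blast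
next
  assume "x \<in> carrier R \<and> (\<exists>n>0. x [^] n \<in> gspan J (powers x n) n)"
  then obtain n where x: "x \<in> carrier R" and n: "n > 0" and xn: "x [^] n \<in> gspan J (powers x n) n" by blast
  have "\<ominus> (x [^] n) \<in> gspan J (powers x n) n"
    using xn additive_subgroup.a_inv_closed[OF ideal.axioms(1)[OF gspan_ideal[OF J powers_closed[OF x]]]]
    by simp
  then obtain b where "\<forall>i\<in>{1..n}. b i \<in> ipow J i" "\<ominus> (x [^] n) = (\<Oplus>i\<in>{1..n}. b i \<otimes> x [^] (n - i))"
    using gspan_powers_expansion[OF J x] by blast
  moreover from this(2) have "x [^] n \<oplus> (\<Oplus>i\<in>{1..n}. b i \<otimes> x [^] (n - i)) = \<zero>"
    using x by (metis nat_pow_closed r_neg)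
  ultimately show "x \<in> integral_closure R J"
    using x n unfolding integral_closure_def ipow_def by blast
qed

text \<open>Polynomials in \<open>x\<close> of degree below \<open>n\<close> and of degree at most
  \<open>m\<close> have a product of degree below \<open>n + m\<close>.\<close>

lemma gspan_powers_mult:
  assumes J: "ideal J R" and x: "x \<in> carrier R"
    and u: "u \<in> gspan J (powers x n) d" and v: "v \<in> gspan J (powers x (Suc m)) e"
  shows "v \<otimes> u \<in> gspan J (powers x (n + m)) (d + e)"
proof (rule gspan_subst[OF J powers_closed[OF x] powers_closed[OF x] _ _ J v])
  show uc: "u \<in> carrier R" using gspan_closed[OF J powers_closed[OF x] u] .
  fix l y w assume *: "(l, y) \<in> powers x (Suc m)" "l \<le> e" "w \<in> ipow J (e - l)"
  then have l: "l \<le> m" "y = x [^] l" by auto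
  have "u \<otimes> x [^] l \<otimes> w \<in> gspan J (powers x (n + l)) (d + l + (e - l))"
    by (rule gspan_smult[OF J powers_closed[OF x] *(3) gspan_powers_shift[OF J x u]])
  then have "u \<otimes> x [^] l \<otimes> w \<in> gspan J (powers x (n + m)) (d + e)"
    using gspan_powers_mono[of "n + l" "n + m"] l(1) *(2) by simp
  moreover have "u \<otimes> x [^] l \<otimes> w = w \<otimes> (y \<otimes> u)"
    using uc x ipow_closed[OF J *(3)] l(2) by (simp add: m_ac)
  ultimately show "w \<otimes> (y \<otimes> u) \<in> gspan J (powers x (n + m)) (d + e)" by simp
qed

text \<open>A power of a monic polynomial is monic. This turns the nilpotence of the value of an
  integral equation into an integral equation that holds.\<close>

lemma monic_power:
  assumes J: "ideal J R" and x: "x \<in> carrier R" and h: "h \<in> gspan J (powers x n) n"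
  shows "\<exists>h'\<in>gspan J (powers x (n * s)) (n * s). (x [^] n \<ominus> h) [^] s = x [^] (n * s) \<ominus> h'"
proof (induction s)
  case 0
  show ?case using x gspan.zero by (intro bexI[of _ \<zero>]) (auto simp: a_minus_def)
next
  case (Suc s)
  let ?g = "x [^] n \<ominus> h"
  note I = gspan_ideal[OF J powers_closed[OF x]]
  obtain h' where h': "h' \<in> gspan J (powers x (n * s)) (n * s)" "?g [^] s = x [^] (n * s) \<ominus> h'"
    using Suc by blast
  have c: "h \<in> carrier R" "h' \<in> carrier R" using ideal.Icarr[OF I] h h'(1) by auto
  have "x [^] n \<in> gspan J (powers x (Suc n)) n" by (rule gspan_base[OF J powers_closed[OF x]]) auto
  then have "?g \<in> gspan J (powers x (Suc n)) n"
    using h gspan_powers_mono[of n "Suc n"] by (intro ideal_minus_closed[OF I]) auto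
  then have 1: "?g \<otimes> h' \<in> gspan J (powers x (n * s + n)) (n * s + n)"
    by (rule gspan_powers_mult[OF J x h'(1)])
  have 2: "h \<otimes> x [^] (n * s) \<in> gspan J (powers x (n * s + n)) (n * s + n)"
    using gspan_powers_shift[OF J x h, of "n * s"] by (simp add: add.commute)
  \<comment> \<open>In \<open>(x [^] (n * s) \<ominus> h') \<otimes> ?g\<close> the factor
    \<open>?g\<close> is expanded only against the leading term.\<close>
  have "?g [^] Suc s = x [^] (n * s + n) \<ominus> (h \<otimes> x [^] (n * s) \<oplus> ?g \<otimes> h')"
    using c x h'(2) by (simp add: nat_pow_mult[symmetric] a_minus_def r_distr l_distr r_minus l_minus minus_add m_ac a_ac)
  then show ?case using gspan_add[OF J powers_closed[OF x] 2 1]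
    by (intro bexI[of _ "h \<otimes> x [^] (n * s) \<oplus> ?g \<otimes> h'"]) (simp_all add: add.commute)
qed

text \<open>Finite generation of the ideal of the Rees algebra generated by all \<open>c x\<^sup>q t\<^bsup>q - k\<^esup>\<close> gives
  a relation \<open>c g = \<zero>\<close> with \<open>g\<close> an integral equation for \<open>x\<close> over \<open>J\<close>. Then \<open>g\<close> lies in every minimal
  prime, so a power of \<open>g\<close> is an integral equation satisfied by \<open>x\<close>.\<close>

lemma integral_closure_criterion:
  fixes p :: nat
  assumes noeth: "noetherian_ring R" and p: "prime p" "[p] \<cdot> \<one> = \<zero>" and J: "ideal J R"
    and x: "x \<in> carrier R" and c: "c \<in> carrier R" "\<And>P. minimal_prime R P \<Longrightarrow> c \<notin> P"
    and freq: "\<exists>\<^sub>\<infinity>e. c \<otimes> x [^] (p ^ e) \<in> ipow J (p ^ e - k)"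
  shows "x \<in> integral_closure R J"
proof -
  \<comment> \<open>The condition \<open>k \<le> p ^ e\<close> rules out truncated subtraction, so
    that the degree \<open>p ^ e - k\<close> determines the exponent of \<open>x\<close>.\<close>
  define E where "E = {e. k \<le> p ^ e \<and> c \<otimes> x [^] (p ^ e) \<in> ipow J (p ^ e - k)}"
  define Y where "Y = (\<lambda>e. (p ^ e - k, c \<otimes> x [^] (p ^ e))) ` E"
  have pe: "e < p ^ e" for e using p(1) prime_gt_1_nat power_gt_expt by simp
  have E: "\<exists>e\<in>E. m < e" for m
  proof -
    obtain e where "e > max m k" "c \<otimes> x [^] (p ^ e) \<in> ipow J (p ^ e - k)"
      using freq by (meson INFM_nat)
    moreover have "k \<le> p ^ e" using pe[of e] \<open>e > max m k\<close> by simp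
    ultimately show ?thesis by (auto simp: E_def)
  qed
  have "\<forall>(d, y)\<in>Y. y \<in> ipow J d" by (auto simp: Y_def E_def)
  then obtain Y0 where Y0: "Y0 \<subseteq> Y" "finite Y0" "\<forall>(d, y)\<in>Y. y \<in> gspan J Y0 d"
    using rees_noetherian_ideal[OF noeth J] unfolding rees_noetherian_def by blast
  obtain D where D: "\<And>d y. (d, y) \<in> Y0 \<Longrightarrow> d \<le> D"
    using Y0(2) finite_nat_set_iff_bounded_le[of "fst ` Y0"] by force
  \<comment> \<open>Large enough for the exponents of \<open>x\<close> in all generators from
    \<open>Y0\<close> to be strictly below \<open>p ^ e\<close>.\<close>
  obtain e where e: "e \<in> E" "D + k < e" using E by blast
  define Q where "Q = p ^ e"
  have Q: "D + k < Q" using e(2) pe[of e] by (simp add: Q_def)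
  note I = gspan_ideal[OF J powers_closed[OF x]]
  \<comment> \<open>A generator of degree \<open>p ^ e' - k\<close> has a coefficient of degree
    \<open>Q - p ^ e'\<close>: the shift \<open>k\<close> cancels, and \<open>c\<close> can be
    factored out of every spanned element.\<close>
  have "\<exists>h\<in>gspan J (powers x Q) Q. v = c \<otimes> h" if "v \<in> gspan J Y0 (Q - k)" for v
    using that
  proof induction
    case zero
    then show ?case using c gspan.zero by (intro bexI[of _ \<zero>]) auto
  next
    case (step f y u v)
    then obtain h where h: "h \<in> gspan J (powers x Q) Q" "v = c \<otimes> h" by blast
    obtain e' where e': "e' \<in> E" "f = p ^ e' - k" "y = c \<otimes> x [^] (p ^ e')"
      using step.hyps(1) Y0(1) by (auto simp: Y_def)
    have "k \<le> p ^ e'" using e'(1) by (simp add: E_def)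
    moreover have "f \<le> D" using D step.hyps(1) .
    ultimately have l: "p ^ e' < Q" and deg: "Q - k - f = Q - p ^ e'" using e'(2) Q by auto
    have "u \<otimes> x [^] (p ^ e') \<in> gspan J (powers x Q) Q"
      using l step.hyps(3) deg by (intro gspan_gen[OF J powers_closed[OF x], of "p ^ e'"]) auto
    then have "u \<otimes> x [^] (p ^ e') \<oplus> h \<in> gspan J (powers x Q) Q"
      using h(1) gspan_add[OF J powers_closed[OF x]] by blast
    moreover have "u \<otimes> y \<oplus> v = c \<otimes> (u \<otimes> x [^] (p ^ e') \<oplus> h)"
      using e'(3) h(2) c x ipow_closed[OF J step.hyps(3)] ideal.Icarr[OF I h(1)]
      by (simp add: r_distr m_ac)
    ultimately show ?case by blast
  qed
  moreover have "c \<otimes> x [^] Q \<in> gspan J Y0 (Q - k)" using Y0(3) e(1) by (auto simp: Y_def Q_def)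
  ultimately obtain h where h: "h \<in> gspan J (powers x Q) Q" "c \<otimes> x [^] Q = c \<otimes> h" by blast
  have hc: "h \<in> carrier R" using ideal.Icarr[OF I h(1)] .
  have "c \<otimes> (x [^] Q \<ominus> h) = \<zero>"
    using h(2) hc c x by (simp add: a_minus_def r_distr r_minus r_neg)
  then obtain s :: nat where "(x [^] Q \<ominus> h) [^] s = \<zero>"
    using nilpotent_if_annihilated[OF p c, of "x [^] Q \<ominus> h"] hc x by auto
  \<comment> \<open>\<open>Suc s\<close> keeps the degree of the resulting integral equation
    positive.\<close>
  then have s: "(x [^] Q \<ominus> h) [^] Suc s = \<zero>" using hc x by simp
  obtain h' where h': "h' \<in> gspan J (powers x (Q * Suc s)) (Q * Suc s)"
    "(x [^] Q \<ominus> h) [^] Suc s = x [^] (Q * Suc s) \<ominus> h'"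
    using monic_power[OF J x h(1)] by blast
  then have "x [^] (Q * Suc s) = h'"
    using s x ideal.Icarr[OF I h'(1)] by (metis nat_pow_closed r_right_minus_eq)
  then have "x [^] (Q * Suc s) \<in> gspan J (powers x (Q * Suc s)) (Q * Suc s)" using h'(1) by simp
  moreover have "Q * Suc s > 0" using Q by simp
  ultimately show ?thesis using integral_closure_iff[OF J] x by blast
qed

text \<open>For \<open>n \<ge> k\<close> an integral equation of degree \<open>k\<close> rewrites
  \<open>x [^] n\<close> by lower powers \<open>x [^] l\<close> with coefficients in
  \<open>ipow J (n - l)\<close>, and induction applies to these. For \<open>n < k\<close> the
  exponent \<open>n - k\<close> is \<open>0\<close>.\<close>

lemma integral_closure_power:
  assumes J: "ideal J R" and "x \<in> integral_closure R J"
  shows "\<exists>k. \<forall>n. x [^] n \<in> ipow J (n - k)"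
proof -
  obtain k where x: "x \<in> carrier R" and k: "x [^] k \<in> gspan J (powers x k) k"
    using assms integral_closure_iff by blast
  have "x [^] n \<in> ipow J (n - k)" for n
  proof (induction n rule: less_induct)
    case (less n)
    show ?case
    proof (cases "n < k")
      case True
      then show ?thesis using x by simp
    next
      case False
      then have "x [^] k \<otimes> x [^] (n - k) \<in> gspan J (powers x n) n"
        using gspan_powers_shift[OF J x k, of "n - k"] by simp
      then have xn: "x [^] n \<in> gspan J (powers x n) n" using x False by (simp add: nat_pow_mult)
      have "v \<in> ipow J (n - k)" if "v \<in> gspan J (powers x n) n" for v
        using that
      proof induction
        case zero
        show ?case using additive_subgroup.zero_closed[OF ideal.axioms(1)[OF ipow_ideal[OF J]]] .
      next
        case (step l y u v)
        have "l < n" "y = x [^] l" using step.hyps(1) by auto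
        then have "y \<in> ipow J (l - k)" using less by simp
        then have "u \<otimes> y \<in> ipow J (n - l + (l - k))" using ipow_mult[OF J step.hyps(3)] by simp
        moreover have "n - k \<le> n - l + (l - k)" using \<open>l < n\<close> by arith
        ultimately have "u \<otimes> y \<in> ipow J (n - k)" using ipow_antimono[OF J] by blast
        then show ?case
          using step.IH additive_subgroup.a_closed[OF ideal.axioms(1)[OF ipow_ideal[OF J]]] by simp
      qed
      then show ?thesis using xn .
    qed
  qed
  then show ?thesis by blast
qed

section \<open>Colon ideals and bracket powers\<close>

text \<open>The colon ideal \<open>(L : S)\<close>, used to check products on generators of one
  factor at a time.\<close>

lemma colon_ideal:
  assumes L: "ideal L R" and S: "S \<subseteq> carrier R"
  shows "ideal {u \<in> carrier R. \<forall>v\<in>S. u \<otimes> v \<in> L} R"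
proof (rule idealI_cring)
  note L' = additive_subgroup.zero_closed[OF ideal.axioms(1)[OF L]]
    additive_subgroup.a_closed[OF ideal.axioms(1)[OF L]] ideal.I_l_closed[OF L]
  show "\<zero> \<in> {u \<in> carrier R. \<forall>v\<in>S. u \<otimes> v \<in> L}" using S L' by auto
  show "a \<oplus> b \<in> {u \<in> carrier R. \<forall>v\<in>S. u \<otimes> v \<in> L}"
    if "a \<in> {u \<in> carrier R. \<forall>v\<in>S. u \<otimes> v \<in> L}" "b \<in> {u \<in> carrier R. \<forall>v\<in>S. u \<otimes> v \<in> L}" for a b
    using that S L' by (auto simp: l_distr subset_iff)
  show "r \<otimes> a \<in> {u \<in> carrier R. \<forall>v\<in>S. u \<otimes> v \<in> L}"
    if "r \<in> carrier R" "a \<in> {u \<in> carrier R. \<forall>v\<in>S. u \<otimes> v \<in> L}" for r a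
    using that S L' by (auto simp: m_assoc subset_iff)
qed auto

lemma ideal_prod_subset:
  assumes "ideal L R" "\<And>i j. i \<in> I \<Longrightarrow> j \<in> J \<Longrightarrow> i \<otimes> j \<in> L"
  shows "ideal_prod R I J \<subseteq> L"
proof
  fix s assume "s \<in> ideal_prod R I J"
  then show "s \<in> L"
    by induction (use assms additive_subgroup.a_closed[OF ideal.axioms(1)[OF assms(1)]] in auto)
qed

lemma bracket_power_gens: "ideal J R \<Longrightarrow> {f [^] q | f. f \<in> J} \<subseteq> carrier R" for q :: nat
  using ideal.Icarr by fastforce

lemma bracket_power_ideal: "ideal J R \<Longrightarrow> ideal (bracket_power R J q) R"
  unfolding bracket_power_def by (intro genideal_ideal bracket_power_gens)

lemma bracket_power_subset:
  assumes "ideal L R" "\<And>f. f \<in> J \<Longrightarrow> f [^] q \<in> L"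
  shows "bracket_power R J q \<subseteq> L"
  unfolding bracket_power_def using assms by (intro genideal_minimal) auto

lemma power_in_bracket_power: "ideal J R \<Longrightarrow> f \<in> J \<Longrightarrow> f [^] q \<in> bracket_power R J q"
  unfolding bracket_power_def using genideal_self[OF bracket_power_gens, of J q] by blast

lemma bracket_power_mono:
  assumes "ideal J R" "ideal K R" "J \<subseteq> K"
  shows "bracket_power R J q \<subseteq> bracket_power R K q"
  using assms by (intro bracket_power_subset bracket_power_ideal power_in_bracket_power) auto

lemma bracket_power_subset_ipow: "ideal J R \<Longrightarrow> bracket_power R J q \<subseteq> ipow J q"
  by (intro bracket_power_subset ipow_ideal nat_pow_in_ipow)

text \<open>Two colon ideals reduce the claim to the generators, where
  \<open>f [^] q \<otimes> g [^] q\<close> is the power of \<open>f \<otimes> g\<close>.\<close>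

lemma bracket_power_mult:
  assumes J: "ideal J R" and K: "ideal K R" and L: "ideal L R"
    and JKL: "\<And>j k. j \<in> J \<Longrightarrow> k \<in> K \<Longrightarrow> j \<otimes> k \<in> L"
    and u: "u \<in> bracket_power R J q" and v: "v \<in> bracket_power R K q"
  shows "u \<otimes> v \<in> bracket_power R L q"
proof -
  let ?L = "bracket_power R L q"
  have L': "ideal ?L R" using bracket_power_ideal[OF L] .
  have vc: "v \<in> carrier R" using ideal.Icarr[OF bracket_power_ideal[OF K] v] .
  have uc: "u \<in> carrier R" using ideal.Icarr[OF bracket_power_ideal[OF J] u] .
  have Jv: "f [^] q \<otimes> v \<in> ?L" if f: "f \<in> J" for f
  proof -
    have fc: "f \<in> carrier R" using ideal.Icarr[OF J f] .
    have "bracket_power R K q \<subseteq> {w \<in> carrier R. \<forall>x\<in>{f [^] q}. w \<otimes> x \<in> ?L}"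
    proof (rule bracket_power_subset[OF colon_ideal[OF L']])
      fix g assume g: "g \<in> K"
      then have gc: "g \<in> carrier R" using ideal.Icarr[OF K] by blast
      have "g [^] q \<otimes> f [^] q = (f \<otimes> g) [^] q" using fc gc by (simp add: nat_pow_distrib m_comm)
      then show "g [^] q \<in> {w \<in> carrier R. \<forall>x\<in>{f [^] q}. w \<otimes> x \<in> ?L}"
        using gc power_in_bracket_power[OF L JKL[OF f g]] by simp
    qed (use fc in auto)
    then show ?thesis using v vc fc m_comm by auto
  qed
  have "bracket_power R J q \<subseteq> {w \<in> carrier R. \<forall>x\<in>{v}. w \<otimes> x \<in> ?L}"
    using Jv ideal.Icarr[OF J] vc by (intro bracket_power_subset colon_ideal L') auto
  then show ?thesis using u by auto
qed

section \<open>Tight closure\<close>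

lemma one_notin_minimal_prime: "minimal_prime R P \<Longrightarrow> \<one> \<notin> P"
  unfolding minimal_prime_def
  using ideal.one_imp_carrier primeideal.I_notcarr primeideal.axioms(1) by metis

lemma mult_notin_minimal_prime:
  "minimal_prime R P \<Longrightarrow> a \<in> carrier R \<Longrightarrow> b \<in> carrier R \<Longrightarrow> a \<notin> P \<Longrightarrow> b \<notin> P \<Longrightarrow> a \<otimes> b \<notin> P"
  unfolding minimal_prime_def using primeideal.I_prime by metis

lemma tight_closureE:
  assumes "x \<in> tight_closure R p J"
  obtains c where "x \<in> carrier R" "c \<in> carrier R" "\<And>P. minimal_prime R P \<Longrightarrow> c \<notin> P"
    "\<forall>\<^sub>F e in sequentially. c \<otimes> x [^] (p ^ e) \<in> bracket_power R J (p ^ e)"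
  using assms unfolding tight_closure_def by blast

lemma tight_closureI:
  assumes "x \<in> carrier R" "c \<in> carrier R" "\<And>P. minimal_prime R P \<Longrightarrow> c \<notin> P"
    "\<forall>\<^sub>F e in sequentially. c \<otimes> x [^] (p ^ e) \<in> bracket_power R J (p ^ e)"
  shows "x \<in> tight_closure R p J"
  using assms unfolding tight_closure_def by blast

lemma subset_tight_closure:
  assumes "ideal J R"
  shows "J \<subseteq> tight_closure R p J"
proof
  fix x assume "x \<in> J"
  then show "x \<in> tight_closure R p J"
    using assms ideal.Icarr[OF assms] power_in_bracket_power[OF assms]
    by (intro tight_closureI[of x \<one>]) (auto simp: one_notin_minimal_prime)
qed

lemma tight_closure_mono:
  assumes "ideal J R" "ideal K R" "J \<subseteq> K"
  shows "tight_closure R p J \<subseteq> tight_closure R p K"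
proof
  fix x assume "x \<in> tight_closure R p J"
  then obtain c where "x \<in> carrier R" "c \<in> carrier R" "\<And>P. minimal_prime R P \<Longrightarrow> c \<notin> P"
    "\<forall>\<^sub>F e in sequentially. c \<otimes> x [^] (p ^ e) \<in> bracket_power R J (p ^ e)"
    by (rule tight_closureE) blast
  then show "x \<in> tight_closure R p K"
    using bracket_power_mono[OF assms] by (intro tight_closureI[of x c]) (auto elim!: eventually_mono)
qed

text \<open>The product of the two multipliers serves for \<open>x \<otimes> y\<close>; it avoids
  the minimal primes because they are prime.\<close>

lemma tight_closure_mult:
  assumes "ideal J R" "ideal K R" "ideal L R" "\<And>j k. j \<in> J \<Longrightarrow> k \<in> K \<Longrightarrow> j \<otimes> k \<in> L"
    and "x \<in> tight_closure R p J" "y \<in> tight_closure R p K"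
  shows "x \<otimes> y \<in> tight_closure R p L"
proof -
  obtain c where c: "x \<in> carrier R" "c \<in> carrier R" "\<And>P. minimal_prime R P \<Longrightarrow> c \<notin> P"
    "\<forall>\<^sub>F e in sequentially. c \<otimes> x [^] (p ^ e) \<in> bracket_power R J (p ^ e)"
    using assms(5) by (rule tight_closureE) blast
  obtain d where d: "y \<in> carrier R" "d \<in> carrier R" "\<And>P. minimal_prime R P \<Longrightarrow> d \<notin> P"
    "\<forall>\<^sub>F e in sequentially. d \<otimes> y [^] (p ^ e) \<in> bracket_power R K (p ^ e)"
    using assms(6) by (rule tight_closureE) blast
  have "\<forall>\<^sub>F e in sequentially. (c \<otimes> d) \<otimes> (x \<otimes> y) [^] (p ^ e) \<in> bracket_power R L (p ^ e)"
    using c(4) d(4)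
  proof eventually_elim
    case (elim e)
    have "(c \<otimes> d) \<otimes> (x \<otimes> y) [^] (p ^ e) = (c \<otimes> x [^] (p ^ e)) \<otimes> (d \<otimes> y [^] (p ^ e))"
      using c d by (simp add: nat_pow_distrib m_ac)
    then show ?case using bracket_power_mult[OF assms(1-4) elim] by simp
  qed
  then show ?thesis
    using c d by (intro tight_closureI[of _ "c \<otimes> d"]) (auto simp: mult_notin_minimal_prime)
qed

lemma tight_closure_ideal:
  fixes p :: nat
  assumes p: "prime p" "[p] \<cdot> \<one> = \<zero>" and J: "ideal J R"
  shows "ideal (tight_closure R p J) R"
proof (rule idealI_cring)
  show "tight_closure R p J \<subseteq> carrier R" by (auto simp: tight_closure_def)
  show "\<zero> \<in> tight_closure R p J"
    using subset_tight_closure[OF J] additive_subgroup.zero_closed[OF ideal.axioms(1)[OF J]] by blast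
next
  fix r x assume r: "r \<in> carrier R" and x: "x \<in> tight_closure R p J"
  \<comment> \<open>Ring multiples are products with an element of the closure of the unit
    ideal.\<close>
  have "r \<in> tight_closure R p (carrier R)" using subset_tight_closure[OF oneideal] r by blast
  then show "r \<otimes> x \<in> tight_closure R p J"
    using tight_closure_mult[OF oneideal J J _ _ x] ideal.I_l_closed[OF J] by blast
next
  fix x y assume x: "x \<in> tight_closure R p J" and y: "y \<in> tight_closure R p J"
  obtain c where c: "x \<in> carrier R" "c \<in> carrier R" "\<And>P. minimal_prime R P \<Longrightarrow> c \<notin> P"
    "\<forall>\<^sub>F e in sequentially. c \<otimes> x [^] (p ^ e) \<in> bracket_power R J (p ^ e)"
    using x by (rule tight_closureE) blast
  obtain d where d: "y \<in> carrier R" "d \<in> carrier R" "\<And>P. minimal_prime R P \<Longrightarrow> d \<notin> P"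
    "\<forall>\<^sub>F e in sequentially. d \<otimes> y [^] (p ^ e) \<in> bracket_power R J (p ^ e)"
    using y by (rule tight_closureE) blast
  \<comment> \<open>The Frobenius map splits the sum, and the common multiplier
    \<open>c \<otimes> d\<close> serves both summands.\<close>
  have "\<forall>\<^sub>F e in sequentially. (c \<otimes> d) \<otimes> (x \<oplus> y) [^] (p ^ e) \<in> bracket_power R J (p ^ e)"
    using c(4) d(4)
  proof eventually_elim
    case (elim e)
    note B = bracket_power_ideal[OF J, of "p ^ e"]
    have "d \<otimes> (c \<otimes> x [^] (p ^ e)) \<oplus> c \<otimes> (d \<otimes> y [^] (p ^ e)) \<in> bracket_power R J (p ^ e)"
      using elim c(2) d(2) ideal.I_l_closed[OF B] additive_subgroup.a_closed[OF ideal.axioms(1)[OF B]] by blast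
    moreover have "(c \<otimes> d) \<otimes> (x \<oplus> y) [^] (p ^ e) = d \<otimes> (c \<otimes> x [^] (p ^ e)) \<oplus> c \<otimes> (d \<otimes> y [^] (p ^ e))"
      using c d by (simp add: frobenius_power_add[OF p] r_distr m_ac)
    ultimately show ?case by simp
  qed
  then show "x \<oplus> y \<in> tight_closure R p J"
    using c d by (intro tight_closureI[of _ "c \<otimes> d"]) (auto simp: mult_notin_minimal_prime)
qed

lemma tight_closure_subset_integral_closure:
  fixes p :: nat
  assumes "noetherian_ring R" and p: "prime p" "[p] \<cdot> \<one> = \<zero>" and J: "ideal J R"
  shows "tight_closure R p J \<subseteq> integral_closure R J"
proof
  fix x assume "x \<in> tight_closure R p J"
  then obtain c where c: "x \<in> carrier R" "c \<in> carrier R" "\<And>P. minimal_prime R P \<Longrightarrow> c \<notin> P"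
    "\<forall>\<^sub>F e in sequentially. c \<otimes> x [^] (p ^ e) \<in> bracket_power R J (p ^ e)"
    by (rule tight_closureE) blast
  have "\<forall>\<^sub>F e in sequentially. c \<otimes> x [^] (p ^ e) \<in> ipow J (p ^ e - 0)"
    using c(4) bracket_power_subset_ipow[OF J] by (auto elim!: eventually_mono)
  then have "\<exists>\<^sub>\<infinity>e. c \<otimes> x [^] (p ^ e) \<in> ipow J (p ^ e - 0)"
    by (simp add: cofinite_eq_sequentially eventually_frequently)
  then show "x \<in> integral_closure R J"
    using c(3) by (intro integral_closure_criterion[OF assms c(1,2)])
qed

section \<open>Integral closure in characteristic \<open>p\<close>\<close>

text \<open>Only the exponents \<open>p ^ e\<close> are tested, since for these the power of a sum
  is the sum of the powers.\<close>

lemma integral_closure_iff_power: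
  fixes p :: nat
  assumes "noetherian_ring R" and p: "prime p" "[p] \<cdot> \<one> = \<zero>" and J: "ideal J R"
  shows "x \<in> integral_closure R J \<longleftrightarrow> x \<in> carrier R \<and> (\<exists>k. \<forall>e. x [^] (p ^ e) \<in> ipow J (p ^ e - k))"
proof
  assume x: "x \<in> integral_closure R J"
  then obtain k where "\<And>n. x [^] n \<in> ipow J (n - k)" using integral_closure_power[OF J] by blast
  moreover have "x \<in> carrier R" using x by (simp add: integral_closure_def)
  ultimately show "x \<in> carrier R \<and> (\<exists>k. \<forall>e. x [^] (p ^ e) \<in> ipow J (p ^ e - k))" by auto
next
  assume "x \<in> carrier R \<and> (\<exists>k. \<forall>e. x [^] (p ^ e) \<in> ipow J (p ^ e - k))"
  then obtain k where x: "x \<in> carrier R" and "\<And>e. \<one> \<otimes> x [^] (p ^ e) \<in> ipow J (p ^ e - k)" by auto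
  then have "\<exists>\<^sub>\<infinity>e. \<one> \<otimes> x [^] (p ^ e) \<in> ipow J (p ^ e - k)" by simp
  then show "x \<in> integral_closure R J"
    using one_notin_minimal_prime by (intro integral_closure_criterion[OF assms x, of \<one>]) auto
qed

lemma subset_integral_closure:
  assumes J: "ideal J R"
  shows "J \<subseteq> integral_closure R J"
proof
  fix x assume x: "x \<in> J"
  then have xc: "x \<in> carrier R" using ideal.Icarr[OF J] by blast
  have "x \<otimes> \<one> \<in> gspan J (powers x 1) 1"
    using x ipow_1[OF J] by (intro gspan_gen[OF J powers_closed[OF xc], of 0]) auto
  then have "x [^] (1::nat) \<in> gspan J (powers x 1) 1" using xc by simp
  then show "x \<in> integral_closure R J" using xc integral_closure_iff[OF J] zero_less_one by blast
qed

lemma integral_closure_mono: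
  assumes "J \<subseteq> K"
  shows "integral_closure R J \<subseteq> integral_closure R K"
  unfolding integral_closure_def ipow_def[symmetric] using ipow_mono[OF assms] by blast

text \<open>Both memberships are weakened to the common exponent \<open>n = p ^ e - max k l\<close>,
  where the product of \<open>ipow J n\<close> and \<open>ipow K n\<close> is the
  \<open>n\<close>-th power of the product ideal.\<close>

lemma integral_closure_mult:
  fixes p :: nat
  assumes noeth: "noetherian_ring R" and p: "prime p" "[p] \<cdot> \<one> = \<zero>"
    and J: "ideal J R" and K: "ideal K R" and L: "ideal L R" and JKL: "ideal_prod R J K \<subseteq> L"
    and x: "x \<in> integral_closure R J" and y: "y \<in> integral_closure R K"
  shows "x \<otimes> y \<in> integral_closure R L"
proof -
  note iff = integral_closure_iff_power[OF noeth p]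
  obtain k where k: "x \<in> carrier R" "\<And>e. x [^] (p ^ e) \<in> ipow J (p ^ e - k)" using x iff[OF J] by blast
  obtain l where l: "y \<in> carrier R" "\<And>e. y [^] (p ^ e) \<in> ipow K (p ^ e - l)" using y iff[OF K] by blast
  have "(x \<otimes> y) [^] (p ^ e) \<in> ipow L (p ^ e - max k l)" for e
  proof -
    let ?n = "p ^ e - max k l"
    have "?n \<le> p ^ e - k" "?n \<le> p ^ e - l" by auto
    then have "x [^] (p ^ e) \<in> ipow J ?n" "y [^] (p ^ e) \<in> ipow K ?n"
      using k(2) l(2) ipow_antimono[OF J] ipow_antimono[OF K] by blast+
    then have "x [^] (p ^ e) \<otimes> y [^] (p ^ e) \<in> ipow (ideal_prod R J K) ?n"
      unfolding ipow_ideal_prod[OF J K] by (rule ideal_prod.prod)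
    then show ?thesis using ipow_mono[OF JKL] k(1) l(1) by (auto simp: nat_pow_distrib)
  qed
  then show ?thesis using iff[OF L] k(1) l(1) by blast
qed

lemma integral_closure_ideal:
  fixes p :: nat
  assumes noeth: "noetherian_ring R" and p: "prime p" "[p] \<cdot> \<one> = \<zero>" and J: "ideal J R"
  shows "ideal (integral_closure R J) R"
proof (rule idealI_cring)
  note iff = integral_closure_iff_power[OF assms]
  show "integral_closure R J \<subseteq> carrier R" by (auto simp: integral_closure_def)
  show "\<zero> \<in> integral_closure R J"
    using subset_integral_closure[OF J] additive_subgroup.zero_closed[OF ideal.axioms(1)[OF J]] by blast
  show "r \<otimes> x \<in> integral_closure R J" if "r \<in> carrier R" "x \<in> integral_closure R J" for r x
  proof -
    have "r \<in> integral_closure R (carrier R)" using subset_integral_closure[OF oneideal] that(1) by blast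
    moreover have "ideal_prod R (carrier R) J \<subseteq> J"
      using ideal.I_l_closed[OF J] by (intro ideal_prod_subset[OF J])
    ultimately show ?thesis using integral_closure_mult[OF noeth p oneideal J J] that(2) by blast
  qed
  fix x y assume "x \<in> integral_closure R J" "y \<in> integral_closure R J"
  then obtain k l where x: "x \<in> carrier R" "\<And>e. x [^] (p ^ e) \<in> ipow J (p ^ e - k)"
    and y: "y \<in> carrier R" "\<And>e. y [^] (p ^ e) \<in> ipow J (p ^ e - l)"
    using iff by metis
  have "(x \<oplus> y) [^] (p ^ e) \<in> ipow J (p ^ e - max k l)" for e
  proof -
    let ?n = "p ^ e - max k l"
    have "?n \<le> p ^ e - k" "?n \<le> p ^ e - l" by auto
    then have "x [^] (p ^ e) \<in> ipow J ?n" "y [^] (p ^ e) \<in> ipow J ?n"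
      using x(2) y(2) ipow_antimono[OF J] by blast+
    then show ?thesis
      using x(1) y(1) additive_subgroup.a_closed[OF ideal.axioms(1)[OF ipow_ideal[OF J]]]
      by (simp add: frobenius_power_add[OF p])
  qed
  then show "x \<oplus> y \<in> integral_closure R J" using iff x(1) y(1) by blast
qed

section \<open>Filtrations\<close>

lemma ideal_filtration_antimono:
  assumes "ideal_filtration R \<aa>" "i \<le> j"
  shows "\<aa> j \<subseteq> \<aa> i"
  using assms(2) by (rule lift_Suc_antimono_le[rotated]) (use assms(1) in \<open>simp add: ideal_filtration_def\<close>)

lemma ideal_filtration_integral_closure:
  fixes p :: nat
  assumes noeth: "noetherian_ring R" and p: "prime p" "[p] \<cdot> \<one> = \<zero>" and "ideal_filtration R \<aa>"
  shows "ideal_filtration R (\<lambda>i. integral_closure R (\<aa> i))"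
proof -
  have \<aa>: "\<And>i. ideal (\<aa> i) R" "\<aa> 0 = carrier R" "\<And>i. \<aa> (Suc i) \<subseteq> \<aa> i"
    "\<And>i j. ideal_prod R (\<aa> i) (\<aa> j) \<subseteq> \<aa> (i + j)"
    using assms(4) by (auto simp: ideal_filtration_def)
  note I = integral_closure_ideal[OF noeth p \<aa>(1)]
  have "integral_closure R (carrier R) = carrier R"
    using subset_integral_closure[OF oneideal] by (auto simp: integral_closure_def)
  moreover have "ideal_prod R (integral_closure R (\<aa> i)) (integral_closure R (\<aa> j)) \<subseteq> integral_closure R (\<aa> (i + j))" for i j
    using integral_closure_mult[OF noeth p \<aa>(1) \<aa>(1) \<aa>(1) \<aa>(4)] by (rule ideal_prod_subset[OF I])
  ultimately show ?thesis
    unfolding ideal_filtration_def using I \<aa>(2) integral_closure_mono[OF \<aa>(3)] by auto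
qed

lemma ideal_filtration_tight_closure:
  fixes p :: nat
  assumes p: "prime p" "[p] \<cdot> \<one> = \<zero>" and "ideal_filtration R \<aa>"
  shows "ideal_filtration R (\<lambda>i. tight_closure R p (\<aa> i))"
proof -
  have \<aa>: "\<And>i. ideal (\<aa> i) R" "\<aa> 0 = carrier R" "\<And>i. \<aa> (Suc i) \<subseteq> \<aa> i"
    "\<And>i j. ideal_prod R (\<aa> i) (\<aa> j) \<subseteq> \<aa> (i + j)"
    using assms(3) by (auto simp: ideal_filtration_def)
  note I = tight_closure_ideal[OF p \<aa>(1)]
  have mult: "x \<otimes> y \<in> \<aa> (i + j)" if "x \<in> \<aa> i" "y \<in> \<aa> j" for x y i j
    using \<aa>(4) ideal_prod.prod[OF that] by blast
  have "tight_closure R p (carrier R) = carrier R"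
    using subset_tight_closure[OF oneideal] by (auto simp: tight_closure_def)
  moreover have "ideal_prod R (tight_closure R p (\<aa> i)) (tight_closure R p (\<aa> j)) \<subseteq> tight_closure R p (\<aa> (i + j))" for i j
    using tight_closure_mult[OF \<aa>(1) \<aa>(1) \<aa>(1) mult] by (rule ideal_prod_subset[OF I])
  ultimately show ?thesis
    unfolding ideal_filtration_def using I \<aa>(2) tight_closure_mono[OF \<aa>(1) \<aa>(1) \<aa>(3)] by auto
qed

text \<open>\<open>D\<close> bounds the degrees of the generators \<open>h\<close>. In the
  coefficient of \<open>k h\<close> at \<open>r\<close> only the products of \<open>k_i\<close> and
  \<open>h_(r - i)\<close> with \<open>r - i \<le> D\<close> matter, and for these
  \<open>k_i\<close> lies in \<open>\<aa> i \<subseteq> \<aa> (r - D)\<close>. The claim follows by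
  looking at the monomials \<open>x t^r\<close>.\<close>

lemma rees_algebra_fin_gen_shift:
  assumes \<aa>: "ideal_filtration R \<aa>" and \<bb>: "\<And>i. ideal (\<bb> i) R"
    and fin: "fin_gen_over (UP R) (rees_algebra R \<aa>) (rees_algebra R \<bb>)"
  shows "\<exists>D. \<forall>r. \<bb> r \<subseteq> \<aa> (r - D)"
proof -
  interpret UP: UP_cring R "UP R" by unfold_locales auto
  have \<aa>I: "ideal (\<aa> i) R" for i using \<aa> by (simp add: ideal_filtration_def)
  note \<aa>_zero = additive_subgroup.zero_closed[OF ideal.axioms(1)[OF \<aa>I]]
  note \<aa>_add = additive_subgroup.a_closed[OF ideal.axioms(1)[OF \<aa>I]]
  obtain gs where gs: "set gs \<subseteq> rees_algebra R \<bb>" "rees_algebra R \<bb> = UP.P.Span (rees_algebra R \<aa>) gs"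
    using fin unfolding fin_gen_over_def by blast
  obtain D where D: "\<And>g. g \<in> set gs \<Longrightarrow> deg R g \<le> D"
    using finite_nat_set_iff_bounded_le[of "deg R ` set gs"] by auto
  have span: "f \<in> carrier (UP R) \<and> (\<forall>r. coeff (UP R) f r \<in> \<aa> (r - D))"
    if "f \<in> UP.P.Span (rees_algebra R \<aa>) hs" "set hs \<subseteq> carrier (UP R)" "\<forall>h\<in>set hs. deg R h \<le> D" for f hs
    using that
  proof (induction hs arbitrary: f)
    case Nil
    then show ?case using \<aa>_zero by simp
  next
    case (Cons h hs)
    have h: "h \<in> carrier (UP R)" "deg R h \<le> D" using Cons.prems by auto
    obtain k f' where k: "k \<in> rees_algebra R \<aa>" and f': "f' \<in> UP.P.Span (rees_algebra R \<aa>) hs"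
      and f: "f = k \<otimes>\<^bsub>UP R\<^esub> h \<oplus>\<^bsub>UP R\<^esub> f'"
      using Cons.prems(1) by (auto simp: UP.P.line_extension_def r_coset_def set_add_def')
    have kc: "k \<in> carrier (UP R)" "\<And>i. coeff (UP R) k i \<in> \<aa> i" using k by (auto simp: rees_algebra_def)
    have f'c: "f' \<in> carrier (UP R)" "\<And>r. coeff (UP R) f' r \<in> \<aa> (r - D)"
      using Cons.IH[OF f'] Cons.prems by auto
    have "coeff (UP R) k i \<otimes> coeff (UP R) h (r - i) \<in> \<aa> (r - D)" if "i \<in> {..r}" for i r
    proof (cases "D < r - i")
      case True
      then have "coeff (UP R) h (r - i) = \<zero>" using h by (intro UP.deg_aboveD) auto
      then show ?thesis using \<aa>_zero kc by simp
    next
      case False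
      then have "r - D \<le> i" by auto
      then have "coeff (UP R) k i \<in> \<aa> (r - D)"
        using kc(2) ideal_filtration_antimono[OF \<aa>] by blast
      then show ?thesis using h ideal.I_r_closed[OF \<aa>I] by simp
    qed
    then have "coeff (UP R) (k \<otimes>\<^bsub>UP R\<^esub> h) r \<in> \<aa> (r - D)" for r
      using kc h by (auto intro: ideal_finsum_closed[OF \<aa>I])
    then show ?case using f kc h f'c \<aa>_add by simp
  qed
  have "x \<in> \<aa> (r - D)" if x: "x \<in> \<bb> r" for x r
  proof -
    have xc: "x \<in> carrier R" using ideal.Icarr[OF \<bb> x] .
    have "monom (UP R) x r \<in> rees_algebra R \<bb>"
      using xc x additive_subgroup.zero_closed[OF ideal.axioms(1)[OF \<bb>]] by (simp add: rees_algebra_def)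
    then have "coeff (UP R) (monom (UP R) x r) r \<in> \<aa> (r - D)"
      using span[of "monom (UP R) x r" gs] gs D by (auto simp: rees_algebra_def)
    then show ?thesis using xc by simp
  qed
  then show ?thesis by blast
qed

end

section \<open>Comparison of the asymptotic invariants\<close>

lemma nu_mono:
  assumes "\<And>i. \<aa> i \<subseteq> \<bb> i"
  shows "nu R p I \<aa> e \<le> nu R p I \<bb> e"
  unfolding nu_def using assms by (intro SUP_subset_mono) auto

text \<open>If \<open>\<bb> r\<close> is not contained in the bracket power, neither is the larger
  \<open>\<aa> (r - D)\<close>. Truncation for \<open>r < D\<close> does no harm, as
  \<open>r \<le> (r - D) + D\<close> always.\<close>

lemma nu_shift:
  assumes "\<And>r. \<bb> r \<subseteq> \<aa> (r - D)"
  shows "nu R p I \<bb> e \<le> nu R p I \<aa> e + enat D"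
  unfolding nu_def
proof (rule SUP_least)
  let ?S = "{r. \<not> \<aa> r \<subseteq> bracket_power R I (p ^ e)}"
  fix r assume "r \<in> {r. \<not> \<bb> r \<subseteq> bracket_power R I (p ^ e)}"
  then have "r - D \<in> ?S" using assms[of r] by auto
  then have "enat (r - D) \<le> (SUP r\<in>?S. enat r)" by (rule SUP_upper)
  then have "enat (r - D) + enat D \<le> (SUP r\<in>?S. enat r) + enat D" by (rule add_right_mono)
  moreover have "enat r \<le> enat (r - D) + enat D" by simp
  ultimately show "enat r \<le> (SUP r\<in>?S. enat r) + enat D" by (rule order_trans[rotated])
qed

text \<open>The null sequence is eventually below any constant \<open>\<epsilon> > 0\<close>, and a
  finite constant can be taken out of both limits even where \<open>f\<close> is infinite.\<close>

lemma Limsup_Liminf_le_add_null: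
  fixes f g :: "nat \<Rightarrow> ereal" and d :: "nat \<Rightarrow> real"
  assumes d: "d \<longlonglongrightarrow> 0" and le: "\<And>n. g n \<le> f n + ereal (d n)"
  shows "limsup g \<le> limsup f" and "liminf g \<le> liminf f"
proof -
  have ev: "\<forall>\<^sub>F n in sequentially. g n \<le> f n + ereal \<epsilon>" if "\<epsilon> > 0" for \<epsilon>
    using order_tendstoD(2)[OF d that]
  proof eventually_elim
    case (elim n)
    then have "f n + ereal (d n) \<le> f n + ereal \<epsilon>" by (intro add_left_mono) simp
    then show ?case using le order_trans by blast
  qed
  show "limsup g \<le> limsup f"
  proof (rule ereal_le_epsilon2)
    fix \<epsilon> :: real assume \<epsilon>: "\<epsilon> > 0"
    show "limsup g \<le> limsup f + ereal \<epsilon>"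
      using Limsup_mono[OF ev[OF \<epsilon>]] Limsup_add_ereal_right[of sequentially "ereal \<epsilon>" f] by simp
  qed
  show "liminf g \<le> liminf f"
  proof (rule ereal_le_epsilon2)
    fix \<epsilon> :: real assume \<epsilon>: "\<epsilon> > 0"
    show "liminf g \<le> liminf f + ereal \<epsilon>"
      using Liminf_mono[OF ev[OF \<epsilon>]] Liminf_add_ereal_right[of sequentially "ereal \<epsilon>" f] by simp
  qed
qed

lemma nu_quotient_mono:
  assumes "m \<le> n" "p > 0"
  shows "ereal_of_enat m / ereal (real (p ^ e)) \<le> ereal_of_enat n / ereal (real (p ^ e))"
  using assms by (intro ereal_divide_right_mono) auto

lemma C_mono:
  assumes "p > 0" "\<And>i. \<aa> i \<subseteq> \<bb> i"
  shows "C_plus R p I \<aa> \<le> C_plus R p I \<bb>" and "C_minus R p I \<aa> \<le> C_minus R p I \<bb>"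
  unfolding C_plus_def C_minus_def
  by (intro Limsup_mono Liminf_mono always_eventually allI nu_quotient_mono nu_mono assms)+

lemma C_shift:
  assumes p: "prime p" and \<aa>\<bb>: "\<And>r. \<bb> r \<subseteq> \<aa> (r - D)"
  shows "C_plus R p I \<bb> \<le> C_plus R p I \<aa>" and "C_minus R p I \<bb> \<le> C_minus R p I \<aa>"
proof -
  have p1: "real p > 1" using prime_gt_1_nat[OF p] by simp
  let ?d = "\<lambda>e. real D / real (p ^ e)"
  have "(\<lambda>e. real D * inverse (real p ^ e)) \<longlonglongrightarrow> real D * 0"
    using p1 by (intro tendsto_mult tendsto_const LIMSEQ_inverse_realpow_zero)
  then have d: "?d \<longlonglongrightarrow> 0" by (simp add: field_simps)
  have le: "ereal_of_enat (nu R p I \<bb> e) / ereal (real (p ^ e))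
      \<le> ereal_of_enat (nu R p I \<aa> e) / ereal (real (p ^ e)) + ereal (?d e)" for e
  proof -
    have "ereal_of_enat (nu R p I \<bb> e) / ereal (real (p ^ e))
        \<le> ereal_of_enat (nu R p I \<aa> e + enat D) / ereal (real (p ^ e))"
      using p by (intro nu_quotient_mono nu_shift \<aa>\<bb> prime_gt_0_nat)
    \<comment> \<open>If \<open>nu\<close> is infinite, so are both sides, since
      \<open>p ^ e\<close> is positive and finite.\<close>
    also have "\<dots> = ereal_of_enat (nu R p I \<aa> e) / ereal (real (p ^ e)) + ereal (?d e)"
      using p1 by (cases "nu R p I \<aa> e") (simp_all add: ereal_of_enat_add add_divide_distrib)
    finally show ?thesis .
  qed
  show "C_plus R p I \<bb> \<le> C_plus R p I \<aa>" "C_minus R p I \<bb> \<le> C_minus R p I \<aa>"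
    unfolding C_plus_def C_minus_def by (rule Limsup_Liminf_le_add_null[OF d le])+
qed

theorem corollary3p8:
  fixes R :: "('a, 'b) ring_scheme" and p :: nat
    and I :: "'a set" and \<aa> :: "nat \<Rightarrow> 'a set"
  assumes "cring R" and "noetherian_ring R"
    and "prime p" and "ring_char R = p"
    and "ideal I R" and "I \<noteq> {\<zero>\<^bsub>R\<^esub>}" and "I \<noteq> carrier R"
    and "ideal_filtration R \<aa>"
    and "fin_gen_over (UP R) (rees_algebra R \<aa>) (rees_algebra R (\<lambda>i. integral_closure R (\<aa> i)))"
  shows "ideal_filtration R (\<lambda>i. integral_closure R (\<aa> i)) \<and>
    ideal_filtration R (\<lambda>i. tight_closure R p (\<aa> i)) \<and>
    C_plus R p I \<aa> = C_plus R p I (\<lambda>i. tight_closure R p (\<aa> i)) \<and>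
    C_plus R p I (\<lambda>i. tight_closure R p (\<aa> i)) = C_plus R p I (\<lambda>i. integral_closure R (\<aa> i)) \<and>
    C_minus R p I \<aa> = C_minus R p I (\<lambda>i. tight_closure R p (\<aa> i)) \<and>
    C_minus R p I (\<lambda>i. tight_closure R p (\<aa> i)) = C_minus R p I (\<lambda>i. integral_closure R (\<aa> i))"
proof -
  interpret cring R by (rule assms)
  have p0: "p > 0" using assms(3) by (rule prime_gt_0_nat)
  then have p: "[p] \<cdot>\<^bsub>R\<^esub> \<one>\<^bsub>R\<^esub> = \<zero>\<^bsub>R\<^esub>"
    by (rule ring_char_add_pow[OF assms(4)])
  have \<aa>: "\<And>i. ideal (\<aa> i) R" using assms(8) by (simp add: ideal_filtration_def)
  let ?t = "\<lambda>i. tight_closure R p (\<aa> i)" and ?c = "\<lambda>i. integral_closure R (\<aa> i)"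
  have sub: "\<And>i. \<aa> i \<subseteq> ?t i" "\<And>i. ?t i \<subseteq> ?c i"
    using subset_tight_closure[OF \<aa>]
      tight_closure_subset_integral_closure[OF assms(2,3) p \<aa>] by auto
  obtain D where D: "\<And>r. ?c r \<subseteq> \<aa> (r - D)"
    using rees_algebra_fin_gen_shift[OF assms(8) integral_closure_ideal[OF assms(2,3) p \<aa>] assms(9)] by blast
  \<comment> \<open>The inequalities from \<open>\<aa>\<close> to the tight closures, on to the
    integral closures and back to \<open>\<aa>\<close> form a cycle, which forces equality.\<close>
  have squeeze: "x = y \<and> y = z" if "x \<le> y" "y \<le> z" "z \<le> x" for x y z :: ereal
    using that by auto
  note t = C_mono[where \<aa> = \<aa> and \<bb> = ?t, OF p0 sub(1), of R I]
    and c = C_mono[where \<aa> = ?t and \<bb> = ?c, OF p0 sub(2), of R I]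
    and c' = C_shift[where \<aa> = \<aa> and \<bb> = ?c, OF assms(3) D, of R I]
  show ?thesis
    using ideal_filtration_integral_closure[OF assms(2,3) p assms(8)]
      ideal_filtration_tight_closure[OF assms(3) p assms(8)]
      squeeze[OF t(1) c(1) c'(1)] squeeze[OF t(2) c(2) c'(2)]
    by simp
qed

end
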